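(* Let $n\ge 2$ and $x_0\in\mathbb{R}^n$, and give $\mathbb{R}^n-\{x_0\}$ the Euclidean metric. Then $$\mathrm{GC}(\mathbb{R}^n-\{x_0\})=\mathrm{TC}(\mathbb{R}^n-\{x_0\})=\begin{cases}1 & n\text{ even}\\ 2 & n\text{ odd.}\end{cases}$$
   Context: Let $I=[0,1]$. For a topological space $Z$, $P(Z)=Z^I$ is the space of continuous maps $I\to Z$ with the compact-open topology, and $P(Z;z_0,z_1)$ is the subspace of paths from $z_0$ to $z_1$. The length of a path in a metric space is the supremum of the sums of distances between successive points on the path. A (minimal) geodesic from $x_0$ to $x_1$ in a metric space $(Z,d)$ is a path $\gamma$ from $x_0$ to $x_1$ with $d(\gamma(t),\gamma(t'))=|t-t'|\,d(x_0,x_1)$ for all $t,t'\in I$. A metric space is geodesic if every pair of its points is joined by a geodesic. Let $X$ be a metric space whose completion $\overline{X}$ is geodesic. For $x_0,x_1\in X$, a near-geodesic from $x_0$ to $x_1$ is a continuous map $\phi:I\to P(\overline{X};x_0,x_1)$ such that (i) $\phi(0)$ is a geodesic in $\overline{X}$ from $x_0$ to $x_1$; (ii) $\phi((0,1])\subset P(X;x_0,x_1)$; (iii) if $s_n\to 0$, then $\operatorname{length}(\phi(s_n))\to\operatorname{length}(\phi(0))$. For $E\subset X\times X$, a near-geodesic motion planning rule (NGMPR) on $E$ is a continuous map $\Phi:E\to P(\overline{X})^I$ such that, for all $(x_0,x_1)\in E$, $\Phi(x_0,x_1)$ is a near-geodesic from $x_0$ to $x_1$, with the additional proviso that $\Phi(x_0,x_1)(0)$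 is a geodesic in $X$ if a geodesic in $X$ from $x_0$ to $x_1$ exists. The geodesic complexity $\mathrm{GC}(X)$ is the smallest $k$ such that $X\times X$ can be partitioned into locally compact sets $E_0,\ldots,E_k$ such that each $E_i$ has an NGMPR. The topological complexity $\mathrm{TC}(X)$ of a topological space $X$ (Farber, reduced version) is the smallest $k$ such that $X\times X$ can be partitioned into locally compact sets $E_0,\ldots,E_k$ on each of which there is a continuous map $s_i:E_i\to P(X)$ with $s_i(x_0,x_1)$ a path from $x_0$ to $x_1$ for all $(x_0,x_1)\in E_i$. *)

theory Defs
  imports "HOL-Analysis.Analysis"
begin

section \<open>Path spaces\<close>

text \<open>The topology generated by the sets of maps carrying a compact \<open>K\<close> into an open \<open>U\<close>.
  As for \<^const>\<open>product_topology\<close>, the points are functions extended by \<^const>\<open>undefined\<close>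
  outside of the domain, so that maps agreeing on \<open>topspace X\<close> are equal.\<close>

definition compact_open_topology :: "'a topology \<Rightarrow> 'b topology \<Rightarrow> ('a \<Rightarrow> 'b) topology" where
  "compact_open_topology X Y = topology_generated_by
     {{f \<in> extensional (topspace X). continuous_map X Y f \<and> f ` K \<subseteq> U} | K U.
        compactin X K \<and> openin Y U}"

lemma topspace_compact_open_topology:
  "topspace (compact_open_topology X Y) = {f \<in> extensional (topspace X). continuous_map X Y f}"
proof -
  have "{f \<in> extensional (topspace X). continuous_map X Y f} \<in>
     {{f \<in> extensional (topspace X). continuous_map X Y f \<and> f ` K \<subseteq> U} | K U.
        compactin X K \<and> openin Y U}"
    by (rule CollectI, rule exI[of _ "{}"], rule exI[of _ "{}"]) auto
  then show ?thesis
    unfolding compact_open_topology_def topology_generated_by_topspace by blast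
qed

definition path_space :: "'a topology \<Rightarrow> (real \<Rightarrow> 'a) topology" where
  "path_space Z = compact_open_topology (top_of_set {0..1}) Z"

definition paths_between :: "'a topology \<Rightarrow> 'a \<Rightarrow> 'a \<Rightarrow> (real \<Rightarrow> 'a) topology" where
  "paths_between Z a b = subtopology (path_space Z) {\<gamma>. \<gamma> 0 = a \<and> \<gamma> 1 = b}"

section \<open>Length and geodesics\<close>

definition path_len :: "(real \<Rightarrow> 'a::metric_space) \<Rightarrow> ennreal" where
  "path_len \<gamma> =
     (SUP (m, t) \<in> {(m::nat, t::nat \<Rightarrow> real). t ` {..m} \<subseteq> {0..1} \<and> mono_on {..m} t}.
        ennreal (\<Sum>i<m. dist (\<gamma> (t i)) (\<gamma> (t (Suc i)))))"

definition geodesic :: "'a::metric_space set \<Rightarrow> 'a \<Rightarrow> 'a \<Rightarrow> (real \<Rightarrow> 'a) \<Rightarrow> bool" where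
  "geodesic Z a b \<gamma> \<longleftrightarrow>
     \<gamma> \<in> topspace (paths_between (top_of_set Z) a b) \<and>
     (\<forall>t\<in>{0..1}. \<forall>t'\<in>{0..1}. dist (\<gamma> t) (\<gamma> t') = \<bar>t - t'\<bar> * dist a b)"

definition geodesic_space :: "'a::metric_space set \<Rightarrow> bool" where
  "geodesic_space Z \<longleftrightarrow> (\<forall>a\<in>Z. \<forall>b\<in>Z. \<exists>\<gamma>. geodesic Z a b \<gamma>)"

section \<open>Near-geodesics\<close>

text \<open>The metric space is a subset \<open>X\<close> of a complete ambient space, with the induced metric.
  Its completion is then realised as \<open>closure X\<close>: this is complete, and contains \<open>X\<close>
  isometrically as a dense subset.\<close>

lemma complete_closure:
  fixes X :: "'a::complete_space set"
  shows "complete (closure X)"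
  by (simp add: complete_eq_closed)

definition near_geodesic ::
    "'a::complete_space set \<Rightarrow> 'a \<Rightarrow> 'a \<Rightarrow> (real \<Rightarrow> real \<Rightarrow> 'a) \<Rightarrow> bool" where
  "near_geodesic X a b \<phi> \<longleftrightarrow>
     continuous_map (top_of_set {0..1}) (paths_between (top_of_set (closure X)) a b) \<phi> \<and>
     geodesic (closure X) a b (\<phi> 0) \<and>
     \<phi> ` {0<..1} \<subseteq> topspace (paths_between (top_of_set X) a b) \<and>
     (\<forall>s. range s \<subseteq> {0..1} \<and> s \<longlonglongrightarrow> 0 \<longrightarrow>
        (\<lambda>n. path_len (\<phi> (s n))) \<longlonglongrightarrow> path_len (\<phi> 0))"

definition NGMPR ::
    "'a::complete_space set \<Rightarrow> ('a \<times> 'a) set \<Rightarrow> ('a \<times> 'a \<Rightarrow> real \<Rightarrow> real \<Rightarrow> 'a) \<Rightarrow> bool" where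
  "NGMPR X E \<Phi> \<longleftrightarrow>
     continuous_map (top_of_set E) (path_space (path_space (top_of_set (closure X)))) \<Phi> \<and>
     (\<forall>(a, b)\<in>E. near_geodesic X a b (\<Phi> (a, b)) \<and>
        ((\<exists>\<gamma>. geodesic X a b \<gamma>) \<longrightarrow> geodesic X a b (\<Phi> (a, b) 0)))"

section \<open>Geodesic and topological complexity\<close>

text \<open>The smallest \<open>k\<close> for which \<open>X \<times> X\<close> can be partitioned into locally compact \<open>E 0, \<dots>, E k\<close>
  all satisfying \<open>P\<close>; it is \<open>\<infinity>\<close> if there is no such \<open>k\<close>.\<close>

definition partition_complexity :: "'a topology \<Rightarrow> (('a \<times> 'a) set \<Rightarrow> bool) \<Rightarrow> enat" where
  "partition_complexity X P = Inf {enat k | k. \<exists>E :: nat \<Rightarrow> ('a \<times> 'a) set.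
     disjoint_family_on E {..k} \<and> (\<Union>i\<le>k. E i) = topspace X \<times> topspace X \<and>
     (\<forall>i\<le>k. locally_compact_space (subtopology (prod_topology X X) (E i)) \<and> P (E i))}"

definition GC :: "'a::complete_space set \<Rightarrow> enat" where
  "GC X = partition_complexity (top_of_set X) (\<lambda>E. \<exists>\<Phi>. NGMPR X E \<Phi>)"

definition TC :: "'a topology \<Rightarrow> enat" where
  "TC X = partition_complexity X
     (\<lambda>E. \<exists>s. continuous_map (subtopology (prod_topology X X) E) (path_space X) s \<and>
        (\<forall>(a, b)\<in>E. s (a, b) \<in> topspace (paths_between X a b)))"

text \<open>The geodesic complexity of \<open>X\<close> is meant for spaces whose completion is geodesic,
  such as punctured Euclidean spaces.\<close>

lemma geodesic_space_closure_punctured: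
  fixes x\<^sub>0 :: "real ^ 'n"
  shows "geodesic_space (closure (UNIV - {x\<^sub>0}))"
proof -
  have "closure (UNIV - {x\<^sub>0}) = UNIV"
    by (metis Compl_eq_Diff_UNIV closure_complement interior_singleton Compl_empty_eq)
  moreover have "geodesic UNIV a b (restrict (linepath a b) {0..1})" for a b :: "real ^ 'n"
  proof -
    have "dist (linepath a b t) (linepath a b t') = \<bar>t - t'\<bar> * dist a b" for t t'
    proof -
      have "linepath a b t - linepath a b t' = (t' - t) *\<^sub>R (a - b)"
        by (simp add: linepath_def algebra_simps)
      then show ?thesis
        by (simp add: dist_norm abs_minus_commute)
    qed
    moreover have "continuous_on {0..1} (restrict (linepath a b) {0..1})"
      by (rule continuous_on_eq[OF continuous_on_linepath]) auto
    ultimately show ?thesis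
      by (auto simp: geodesic_def paths_between_def path_space_def
          topspace_compact_open_topology linepath_0' linepath_1')
  qed
  ultimately show ?thesis
    unfolding geodesic_space_def by auto
qed

end

theory Submission
  imports Defs "HOL-Homology.Brouwer_Degree"
begin

text \<open>
  Write \<open>X\<close> for \<open>\<real>\<^sup>n\<close> with the point \<open>x\<^sub>0\<close> removed. A near-geodesic motion planner evaluated at
  parameter 1 is a motion planner in \<open>X\<close>, so \<open>TC X \<le> GC X\<close>. It remains to bound \<open>GC X\<close> from above
  and \<open>TC X\<close> from below by the same number.

  \<^bold>\<open>Upper bound.\<close> Geodesics of \<open>\<real>\<^sup>n\<close> are segments. Where the segment from \<open>a\<close> to \<open>b\<close> misses \<open>x\<^sub>0\<close>, it
  is itself the path to take. The remaining pairs form a closed set; there \<open>b - x\<^sub>0\<close> is a negative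
  multiple of \<open>a - x\<^sub>0\<close>, and adding \<open>s t (1 - t) v\<close> to the segment, with \<open>v \<noteq> 0\<close> orthogonal to
  \<open>a - x\<^sub>0\<close>, gives a path around \<open>x\<^sub>0\<close> that approaches the segment, also in length, as \<open>s \<rightarrow> 0\<close>
  (\<open>NGMPR_bent_path\<close>, \<open>NGMPR_perpendicular\<close>). For even \<open>n\<close> such a \<open>v\<close> depends continuously on \<open>a\<close>
  everywhere, by means of a complex structure on \<open>\<real>\<^sup>n\<close>. For odd \<open>n\<close> one takes the part of a fixed
  vector \<open>u\<close> orthogonal to \<open>a - x\<^sub>0\<close>, which works unless \<open>a - x\<^sub>0\<close> is on the line of \<open>u\<close>, and on this
  third set a constant vector orthogonal to \<open>u\<close> (\<open>GC_punctured_le\<close>).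

  \<^bold>\<open>Lower bound.\<close> One section over all of \<open>X \<times> X\<close> would contract a sphere. Suppose that
  two locally compact sets covering \<open>X \<times> X\<close> have sections. Restrict to \<open>S \<times> S\<close> for the unit
  sphere \<open>S\<close>. Following the sections partially gives homotopies \<open>f\<^sub>t\<close> and \<open>g\<^sub>t\<close> of maps
  \<open>S \<times> S \<rightarrow> \<real>\<^sup>n - 0\<close>, starting at the two projections, such that at each point \<open>(x, y)\<close> we have
  \<open>f\<^sub>1 = y\<close> or \<open>g\<^sub>1 = x\<close> (\<open>deformations_from_two_sections\<close>). Extend the normalised maps to
  \<open>\<real>\<^sup>n \<times> \<real>\<^sup>n\<close>, homogeneously of degree 1 in each variable, calling the extensions \<open>\<Phi>\<^sub>t\<close> and \<open>\<Gamma>\<^sub>t\<close>.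
  On the unit sphere of \<open>\<real>\<^sup>n \<times> \<real>\<^sup>n\<close> the maps \<open>z \<mapsto> z + r (\<Gamma>\<^sub>1 z, \<Phi>\<^sub>1 z)\<close> have no zero for \<open>r \<ge> 0\<close>: at a zero, \<open>x\<close> is a
  negative multiple of \<open>g\<^sub>1\<close> and \<open>y\<close> one of \<open>f\<^sub>1\<close>, taken at the directions of \<open>x\<close> and \<open>y\<close>. At
  \<open>r = 2\<close> one can return to \<open>t = 0\<close>, because zeros require \<open>\<bar>x\<bar> = \<bar>y\<bar> = 1/r\<close>, which is off the unit
  sphere unless \<open>r\<^sup>2 = 2\<close>. Hence the identity is homotopic, without zeros, to the explicit map
  \<open>(x, y) \<mapsto> (x + 2 \<bar>x\<bar> y, y + 2 \<bar>y\<bar> x)\<close>, hence to the swap \<open>(y, x)\<close>, hence to \<open>(- x, y)\<close>. The last map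
  has degree \<open>(- 1)\<^sup>n\<close>, so that \<open>n\<close> is even (\<open>even_DIM_if_two_deformations\<close>). For odd \<open>n\<close>, three sets
  are therefore needed. The argument replaces the fixed point theorem for maps of \<open>S \<times> S\<close> homotopic to
  \<open>(x, y) \<mapsto> (- y, - x)\<close>, whose Lefschetz number is 2 for odd \<open>n\<close>, by degrees of maps between spheres: \<open>(x, y) \<mapsto> (- g\<^sub>1, - f\<^sub>1)\<close>, normalised, is such a map without
  fixed points.
\<close>

section \<open>Paths and the compact-open topology\<close>

abbreviation unit_interval :: "real topology" where
  "unit_interval \<equiv> top_of_set {0..1}"

lemma topspace_path_space:
  "topspace (path_space Z) = {\<gamma> \<in> extensional {0..1}. continuous_map unit_interval Z \<gamma>}"
  by (simp add: path_space_def topspace_compact_open_topology)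

lemma openin_path_space_subbasic:
  assumes "compact K" "K \<subseteq> {0..1}" "openin Z U"
  shows "openin (path_space Z) {\<gamma> \<in> topspace (path_space Z). \<gamma> ` K \<subseteq> U}"
proof -
  have "{\<gamma> \<in> topspace (path_space Z). \<gamma> ` K \<subseteq> U} =
      {f \<in> extensional (topspace unit_interval). continuous_map unit_interval Z f \<and> f ` K \<subseteq> U}"
    by (auto simp: topspace_path_space)
  moreover have "compactin unit_interval K"
    using assms by (simp add: compactin_subtopology)
  ultimately show ?thesis
    unfolding path_space_def compact_open_topology_def
    using assms by (intro topology_generated_by_Basis) blast
qed

text \<open>For compact \<open>K\<close>, the tube lemma makes the set of \<open>w\<close> with \<open>h w ` K \<subseteq> U\<close> open. Applied twice,
  with \<open>Z\<close> itself a path space the second time, this gives continuity of a family of homotopies of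
  paths.\<close>
lemma continuous_map_curry_path_space:
  assumes h: "continuous_map (prod_topology W unit_interval) Z (\<lambda>(w, t). h w t)"
  shows "continuous_map W (path_space Z) (\<lambda>w. restrict (h w) {0..1})"
  unfolding path_space_def compact_open_topology_def
proof (rule continuous_on_generated_topo)
  have path: "continuous_map unit_interval Z (restrict (h w) {0..1})" if "w \<in> topspace W" for w
  proof -
    have "continuous_map unit_interval Z ((\<lambda>(w, t). h w t) \<circ> (\<lambda>t. (w, t)))"
      by (rule continuous_map_compose[OF _ h]) (use that in \<open>auto intro!: continuous_intros simp: continuous_map_pairwise o_def\<close>)
    then show ?thesis
      by (rule continuous_map_eq) auto
  qed
  show "(\<lambda>w. restrict (h w) {0..1}) ` topspace W \<subseteq>
    \<Union> {{f \<in> extensional (topspace unit_interval). continuous_map unit_interval Z f \<and> f ` K \<subseteq> U} | K U.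
        compactin unit_interval K \<and> openin Z U}"
  proof (rule image_subsetI)
    fix w assume "w \<in> topspace W"
    then have "restrict (h w) {0..1} \<in> topspace (compact_open_topology unit_interval Z)"
      using path by (simp add: topspace_compact_open_topology)
    then show "restrict (h w) {0..1} \<in> \<Union> {{f \<in> extensional (topspace unit_interval).
        continuous_map unit_interval Z f \<and> f ` K \<subseteq> U} | K U. compactin unit_interval K \<and> openin Z U}"
      unfolding compact_open_topology_def topology_generated_by_topspace .
  qed
  fix B
  assume "B \<in> {{f \<in> extensional (topspace unit_interval). continuous_map unit_interval Z f \<and> f ` K \<subseteq> U} | K U.
        compactin unit_interval K \<and> openin Z U}"
  then obtain K U where B: "B = {f \<in> extensional (topspace unit_interval). continuous_map unit_interval Z f \<and> f ` K \<subseteq> U}"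
    and K: "compactin unit_interval K" and U: "openin Z U"
    by blast
  have K01: "K \<subseteq> {0..1}"
    using K by (auto simp: compactin_subtopology)
  have pre: "(\<lambda>w. restrict (h w) {0..1}) -` B \<inter> topspace W = {w \<in> topspace W. h w ` K \<subseteq> U}"
    using path K01 by (auto simp: B image_subset_iff subset_iff)
  let ?O = "{p \<in> topspace (prod_topology W unit_interval). (case p of (w, t) \<Rightarrow> h w t) \<in> U}"
  have O: "openin (prod_topology W unit_interval) ?O"
    by (rule openin_continuous_map_preimage[OF h U])
  have "\<exists>N. openin W N \<and> w \<in> N \<and> N \<subseteq> {w \<in> topspace W. h w ` K \<subseteq> U}"
    if "w \<in> topspace W" "h w ` K \<subseteq> U" for w
  proof -
    have "{w} \<times> K \<subseteq> ?O"
      using that K01 by auto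
    from tube_lemma_right[OF O K that(1) this] obtain N M where
      "openin W N" "openin unit_interval M" "w \<in> N" "K \<subseteq> M" "N \<times> M \<subseteq> ?O"
      by blast
    moreover from this have "N \<subseteq> {w \<in> topspace W. h w ` K \<subseteq> U}"
      using openin_subset by fastforce
    ultimately show ?thesis
      by blast
  qed
  then show "openin W ((\<lambda>w. restrict (h w) {0..1}) -` B \<inter> topspace W)"
    unfolding pre by (intro iffD2[OF openin_subopen]) blast
qed

text \<open>The evaluation map is continuous because the unit interval is locally compact: a point \<open>t\<close> has a
  compact neighbourhood \<open>K\<close> that \<open>s w\<close> maps into \<open>U\<close>, and then so does every nearby path.\<close>
lemma continuous_map_uncurry_path_space:
  assumes s: "continuous_map W (path_space Z) s"
  shows "continuous_map (prod_topology W unit_interval) Z (\<lambda>(w, t). s w t)"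
proof -
  have path: "continuous_map unit_interval Z (s w)" if "w \<in> topspace W" for w
    using continuous_map_image_subset_topspace[OF s] that by (auto simp: topspace_path_space)
  show ?thesis
    unfolding continuous_map
  proof (intro conjI allI impI)
    show "(\<lambda>(w, t). s w t) ` topspace (prod_topology W unit_interval) \<subseteq> topspace Z"
      using path continuous_map_image_subset_topspace by fastforce
    fix U assume U: "openin Z U"
    let ?O = "{p \<in> topspace (prod_topology W unit_interval). (case p of (w, t) \<Rightarrow> s w t) \<in> U}"
    have "\<exists>N. openin (prod_topology W unit_interval) N \<and> (w, t) \<in> N \<and> N \<subseteq> ?O"
      if w: "w \<in> topspace W" and t: "t \<in> {0..1}" and sU: "s w t \<in> U" for w t
    proof -
      have "openin unit_interval {t \<in> topspace unit_interval. s w t \<in> U}"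
        by (rule openin_continuous_map_preimage[OF path[OF w] U])
      then obtain e where e: "e > 0" "\<And>r. r \<in> {0..1} \<Longrightarrow> dist r t < e \<Longrightarrow> s w r \<in> U"
        using t sU unfolding openin_euclidean_subtopology_iff by (auto simp: dist_commute)
      define K where "K = {0..1} \<inter> cball t (e/2)"
      have K: "compact K" "K \<subseteq> {0..1}"
        by (auto simp: K_def intro: compact_Int)
      let ?N = "{w \<in> topspace W. s w \<in> {\<gamma> \<in> topspace (path_space Z). \<gamma> ` K \<subseteq> U}}"
      have N: "openin W ?N"
        by (rule openin_continuous_map_preimage[OF s openin_path_space_subbasic[OF K U]])
      have M: "openin unit_interval ({0..1} \<inter> ball t (e/2))"
        by (simp add: openin_open_Int)
      show ?thesis
      proof (intro exI[of _ "?N \<times> ({0..1} \<inter> ball t (e/2))"] conjI)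
        show "openin (prod_topology W unit_interval) (?N \<times> ({0..1} \<inter> ball t (e/2)))"
          using N M by (simp add: openin_prod_Times_iff)
        have "s w \<in> topspace (path_space Z)"
          using continuous_map_image_subset_topspace[OF s] w by blast
        then show "(w, t) \<in> ?N \<times> ({0..1} \<inter> ball t (e/2))"
          using w t e by (auto simp: K_def dist_commute)
        show "?N \<times> ({0..1} \<inter> ball t (e/2)) \<subseteq> ?O"
          by (auto simp: K_def)
      qed
    qed
    then show "openin (prod_topology W unit_interval) ?O"
      by (intro iffD2[OF openin_subopen]) auto
  qed
qed

lemma subtopology_prod_top_of_set:
  assumes "E \<subseteq> X \<times> Y"
  shows "subtopology (prod_topology (top_of_set X) (top_of_set Y)) E = top_of_set E"
  using assms by (simp add: subtopology_subtopology inf.absorb2)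

lemma motion_planner_uncurry:
  fixes X :: "'a::euclidean_space set"
  assumes E: "E \<subseteq> X \<times> X"
    and s: "continuous_map (subtopology (prod_topology (top_of_set X) (top_of_set X)) E) (path_space (top_of_set X)) s"
  shows "continuous_on (E \<times> {0..1}) (\<lambda>(e, t). s e t)" "\<And>e t. e \<in> E \<Longrightarrow> t \<in> {0..1} \<Longrightarrow> s e t \<in> X"
proof -
  have "continuous_map (prod_topology (top_of_set E) unit_interval) (top_of_set X) (\<lambda>(e, t). s e t)"
    using continuous_map_uncurry_path_space[OF s] unfolding subtopology_prod_top_of_set[OF E] .
  then have "continuous_map (top_of_set (E \<times> {0..1})) (top_of_set X) (\<lambda>(e, t). s e t)"
    by simp
  then show "continuous_on (E \<times> {0..1}) (\<lambda>(e, t). s e t)" "\<And>e t. e \<in> E \<Longrightarrow> t \<in> {0..1} \<Longrightarrow> s e t \<in> X"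
    by (auto simp: Pi_iff continuous_map_in_subtopology)
qed

lemma locally_compact_space_top_of_set_iff:
  fixes E :: "'a::euclidean_space set"
  shows "locally_compact_space (top_of_set E) \<longleftrightarrow> locally compact E"
  unfolding locally_compact locally_compact_space_def compactin_subtopology compactin_euclidean_iff
    topspace_euclidean_subtopology
  by (intro ball_cong refl) meson

section \<open>Comparing partition complexities\<close>

lemma partition_complexity_le:
  assumes "disjoint_family_on E {..k}" "(\<Union>i\<le>k. E i) = topspace X \<times> topspace X"
    and "\<And>i. i \<le> k \<Longrightarrow> locally_compact_space (subtopology (prod_topology X X) (E i))"
    and "\<And>i. i \<le> k \<Longrightarrow> P (E i)"
  shows "partition_complexity X P \<le> enat k"
  unfolding partition_complexity_def
  by (intro Inf_lower CollectI exI[of _ k] exI[of _ E] conjI allI impI refl assms)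

lemma partition_complexity_ge:
  assumes "\<And>k E. disjoint_family_on E {..k} \<Longrightarrow> (\<Union>i\<le>k. E i) = topspace X \<times> topspace X \<Longrightarrow>
    (\<And>i. i \<le> k \<Longrightarrow> locally_compact_space (subtopology (prod_topology X X) (E i))) \<Longrightarrow>
    (\<And>i. i \<le> k \<Longrightarrow> P (E i)) \<Longrightarrow> n \<le> k"
  shows "enat n \<le> partition_complexity X P"
  unfolding partition_complexity_def
proof (rule Inf_greatest)
  fix x
  assume "x \<in> {enat k | k. \<exists>E :: nat \<Rightarrow> ('a \<times> 'a) set. disjoint_family_on E {..k} \<and>
      (\<Union>i\<le>k. E i) = topspace X \<times> topspace X \<and>
      (\<forall>i\<le>k. locally_compact_space (subtopology (prod_topology X X) (E i)) \<and> P (E i))}"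
  then obtain k E where "x = enat k" "disjoint_family_on E {..k}" "(\<Union>i\<le>k. E i) = topspace X \<times> topspace X"
      "\<forall>i\<le>k. locally_compact_space (subtopology (prod_topology X X) (E i)) \<and> P (E i)"
    by blast
  then show "enat n \<le> x"
    using assms[of E k] by simp
qed

lemma partition_complexity_mono:
  assumes "\<And>E. E \<subseteq> topspace X \<times> topspace X \<Longrightarrow> P E \<Longrightarrow> Q E"
  shows "partition_complexity X Q \<le> partition_complexity X P"
  unfolding partition_complexity_def
proof (rule Inf_superset_mono, rule subsetI)
  fix n
  assume "n \<in> {enat k | k. \<exists>E :: nat \<Rightarrow> ('a \<times> 'a) set. disjoint_family_on E {..k} \<and>
      (\<Union>i\<le>k. E i) = topspace X \<times> topspace X \<and>
      (\<forall>i\<le>k. locally_compact_space (subtopology (prod_topology X X) (E i)) \<and> P (E i))}"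
  then obtain k E where E: "n = enat k" "disjoint_family_on E {..k}" "(\<Union>i\<le>k. E i) = topspace X \<times> topspace X"
      "\<forall>i\<le>k. locally_compact_space (subtopology (prod_topology X X) (E i)) \<and> P (E i)"
    by blast
  then have "\<forall>i\<le>k. Q (E i)"
    using assms by (metis UN_upper atMost_iff)
  with E show "n \<in> {enat k | k. \<exists>E :: nat \<Rightarrow> ('a \<times> 'a) set. disjoint_family_on E {..k} \<and>
      (\<Union>i\<le>k. E i) = topspace X \<times> topspace X \<and>
      (\<forall>i\<le>k. locally_compact_space (subtopology (prod_topology X X) (E i)) \<and> Q (E i))}"
    by blast
qed

text \<open>At parameter 1 a near-geodesic runs inside \<open>X\<close>. Uncurrying and currying again changes the
  codomain of the planner from the closure of \<open>X\<close> to \<open>X\<close>.\<close>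
lemma TC_le_GC:
  fixes X :: "'a::euclidean_space set"
  shows "TC (top_of_set X) \<le> GC X"
  unfolding TC_def GC_def
proof (rule partition_complexity_mono)
  fix E assume "E \<subseteq> topspace (top_of_set X) \<times> topspace (top_of_set X)" and "\<exists>\<Phi>. NGMPR X E \<Phi>"
  then obtain \<Phi> where E: "E \<subseteq> X \<times> X" and \<Phi>: "NGMPR X E \<Phi>"
    by auto
  have ends: "\<Phi> e 1 \<in> topspace (paths_between (top_of_set X) (fst e) (snd e))" if "e \<in> E" for e
    using \<Phi> that by (force simp: NGMPR_def near_geodesic_def)
  then have path: "\<Phi> e 1 \<in> extensional {0..1}" "\<Phi> e 1 t \<in> X" if "e \<in> E" "t \<in> {0..1}" for e t
    using that by (fastforce simp: paths_between_def topspace_path_space continuous_map_in_subtopology)+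
  have "continuous_map (prod_topology (top_of_set E) unit_interval) (path_space (top_of_set (closure X)))
      (\<lambda>(e, s). \<Phi> e s)"
    using \<Phi> by (intro continuous_map_uncurry_path_space) (simp add: NGMPR_def)
  then have "continuous_map (top_of_set E) (path_space (top_of_set (closure X))) ((\<lambda>(e, s). \<Phi> e s) \<circ> (\<lambda>e. (e, 1)))"
    by (rule continuous_map_compose[rotated]) (auto simp: continuous_map_pairwise o_def intro!: continuous_intros)
  then have "continuous_map (prod_topology (top_of_set E) unit_interval) (top_of_set (closure X)) (\<lambda>(e, t). \<Phi> e 1 t)"
    by (intro continuous_map_uncurry_path_space) (simp add: o_def)
  then have "continuous_map (prod_topology (top_of_set E) unit_interval) (top_of_set X) (\<lambda>(e, t). \<Phi> e 1 t)"
    using path(2) by (auto simp: continuous_map_in_subtopology)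
  then have "continuous_map (top_of_set E) (path_space (top_of_set X)) (\<lambda>e. restrict (\<Phi> e 1) {0..1})"
    by (rule continuous_map_curry_path_space)
  then have "continuous_map (top_of_set E) (path_space (top_of_set X)) (\<lambda>e. \<Phi> e 1)"
    by (rule continuous_map_eq) (use path(1)[of _ 0] in \<open>simp add: extensional_restrict\<close>)
  then show "\<exists>s. continuous_map (subtopology (prod_topology (top_of_set X) (top_of_set X)) E)
      (path_space (top_of_set X)) s \<and> (\<forall>(a, b)\<in>E. s (a, b) \<in> topspace (paths_between (top_of_set X) a b))"
    unfolding subtopology_prod_top_of_set[OF E]
    by (intro exI[of _ "\<lambda>e. \<Phi> e 1"]) (use ends in force)
qed

section \<open>Bending a segment around the puncture\<close>

lemma path_len_ge_dist: "ennreal (dist (\<gamma> 0) (\<gamma> 1)) \<le> path_len \<gamma>"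
  unfolding path_len_def
  by (rule SUP_upper2[of "(1, real)"]) (auto simp: mono_on_def atMost_Suc)

text \<open>The sums that define the length telescope under a Lipschitz bound.\<close>
lemma path_len_le_lipschitz:
  assumes L: "\<And>t t'. t \<in> {0..1} \<Longrightarrow> t' \<in> {0..1} \<Longrightarrow> dist (\<gamma> t) (\<gamma> t') \<le> L * \<bar>t - t'\<bar>"
  shows "path_len \<gamma> \<le> ennreal L"
  unfolding path_len_def
proof (rule SUP_least)
  fix p assume "p \<in> {(m::nat, t::nat \<Rightarrow> real). t ` {..m} \<subseteq> {0..1} \<and> mono_on {..m} t}"
  then obtain m t where p: "p = (m, t)" and t: "t ` {..m} \<subseteq> {0..1}" "mono_on {..m} t"
    by blast
  have "L \<ge> 0"
    using order_trans[OF zero_le_dist L[of 0 1]] by simp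
  have "(\<Sum>i<m. dist (\<gamma> (t i)) (\<gamma> (t (Suc i)))) \<le> (\<Sum>i<m. L * (t (Suc i) - t i))"
  proof (rule sum_mono)
    fix i assume i: "i \<in> {..<m}"
    then have "t i \<le> t (Suc i)"
      using t(2) by (auto simp: mono_on_def)
    then show "dist (\<gamma> (t i)) (\<gamma> (t (Suc i))) \<le> L * (t (Suc i) - t i)"
      using L[of "t i" "t (Suc i)"] t(1) i by (auto simp: image_subset_iff abs_minus_commute)
  qed
  also have "\<dots> = L * (t m - t 0)"
    by (simp add: sum_lessThan_telescope flip: sum_distrib_left)
  also have "\<dots> \<le> L * 1"
  proof (rule mult_left_mono[OF _ \<open>L \<ge> 0\<close>])
    have "t m \<in> {0..1}" "t 0 \<in> {0..1}"
      using t(1) by auto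
    then show "t m - t 0 \<le> 1"
      by auto
  qed
  finally show "(case p of (m, t) \<Rightarrow> ennreal (\<Sum>i<m. dist (\<gamma> (t i)) (\<gamma> (t (Suc i))))) \<le> ennreal L"
    by (simp add: p ennreal_leI)
qed

lemma dist_linepath: "dist (linepath a b t) (linepath a b t') = \<bar>t - t'\<bar> * dist a b"
proof -
  have "linepath a b t - linepath a b t' = (t' - t) *\<^sub>R (a - b)"
    by (simp add: linepath_def algebra_simps)
  then show ?thesis
    by (simp add: dist_norm abs_minus_commute)
qed

lemma geodesic_linepath:
  fixes a b :: "'a::real_normed_vector"
  assumes "linepath a b ` {0..1} \<subseteq> Z"
  shows "geodesic Z a b (restrict (linepath a b) {0..1})"
proof -
  have "continuous_on {0..1} (restrict (linepath a b) {0..1})"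
    by (rule continuous_on_eq[OF continuous_on_linepath]) auto
  then show ?thesis
    using assms by (auto simp: geodesic_def paths_between_def topspace_path_space dist_linepath
        linepath_0' linepath_1' continuous_map_in_subtopology)
qed

text \<open>Geodesics between given points of an inner product space are unique: the distances of \<open>\<gamma> t\<close> from
  \<open>a\<close> and \<open>b\<close> determine the inner product of \<open>\<gamma> t - a\<close> with \<open>b - a\<close>, and then
  \<open>\<gamma> t - a - t (b - a)\<close> has norm 0. Hence a geodesic in a subset \<open>Z\<close> exists only if the segment lies
  in \<open>Z\<close>.\<close>
lemma geodesic_eq_linepath:
  fixes a b :: "'a::real_inner"
  assumes \<gamma>: "geodesic Z a b \<gamma>" and t: "t \<in> {0..1}"
  shows "\<gamma> t = linepath a b t"
proof -
  define w u where "w = \<gamma> t - a" and "u = b - a"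
  have ends: "\<gamma> 0 = a" "\<gamma> 1 = b"
    using \<gamma> by (auto simp: geodesic_def paths_between_def)
  have "dist (\<gamma> t) (\<gamma> 0) = \<bar>t - 0\<bar> * dist a b" "dist (\<gamma> t) (\<gamma> 1) = \<bar>t - 1\<bar> * dist a b"
    using \<gamma> t unfolding geodesic_def by (meson atLeastAtMost_iff order_refl zero_le_one)+
  then have "norm w = t * norm u" "norm (w - u) = (1 - t) * norm u"
    using t by (auto simp: w_def u_def ends dist_norm norm_minus_commute)
  then have "w \<bullet> w = t\<^sup>2 * (u \<bullet> u)" "(w - u) \<bullet> (w - u) = (1 - t)\<^sup>2 * (u \<bullet> u)"
    by (simp_all add: power_mult_distrib flip: power2_norm_eq_inner)
  then have "(w - t *\<^sub>R u) \<bullet> (w - t *\<^sub>R u) = 0"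
    by (simp add: inner_diff inner_commute[of u w] power2_eq_square algebra_simps) algebra
  then have "w - t *\<^sub>R u = 0"
    by (simp only: inner_eq_zero_iff)
  then show ?thesis
    by (simp add: w_def u_def linepath_def algebra_simps)
qed

text \<open>The factor \<open>t (1 - t)\<close> keeps the end points in place. It is 1-Lipschitz on the unit interval,
  which bounds the length added to that of the segment by \<open>s \<bar>v\<bar>\<close>.\<close>
definition bent_path :: "'a::real_normed_vector \<Rightarrow> 'a \<Rightarrow> 'a \<Rightarrow> real \<Rightarrow> real \<Rightarrow> 'a" where
  "bent_path a b v s t = linepath a b t + (s * (t * (1 - t))) *\<^sub>R v"

lemma dist_bent_path_le:
  assumes "t \<in> {0..1}" "t' \<in> {0..1}" "0 \<le> s"
  shows "dist (bent_path a b v s t) (bent_path a b v s t') \<le> (dist a b + s * norm v) * \<bar>t - t'\<bar>"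
proof -
  have "bent_path a b v s t - bent_path a b v s t' =
      (linepath a b t - linepath a b t') + (s * ((t - t') * (1 - t - t'))) *\<^sub>R v"
    by (simp add: bent_path_def algebra_simps)
  then have "dist (bent_path a b v s t) (bent_path a b v s t') \<le>
      dist (linepath a b t) (linepath a b t') + norm ((s * ((t - t') * (1 - t - t'))) *\<^sub>R v)"
    unfolding dist_norm by (metis norm_triangle_ineq)
  also have "norm ((s * ((t - t') * (1 - t - t'))) *\<^sub>R v) = s * norm v * \<bar>t - t'\<bar> * \<bar>1 - t - t'\<bar>"
    using assms(3) by (simp add: abs_mult)
  also have "\<dots> \<le> s * norm v * \<bar>t - t'\<bar> * 1"
    using assms by (intro mult_left_mono) auto
  finally show ?thesis
    by (simp add: dist_linepath algebra_simps)
qed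

lemma path_len_bent_path_le:
  assumes "0 \<le> s"
  shows "path_len (restrict (bent_path a b v s) {0..1}) \<le> ennreal (dist a b + s * norm v)"
  using dist_bent_path_le[OF _ _ assms] by (intro path_len_le_lipschitz) simp

text \<open>The length lies between \<open>dist a b\<close> and \<open>dist a b + s \<bar>v\<bar>\<close>.\<close>
lemma path_len_bent_path_tendsto:
  fixes a b v :: "'a::real_normed_vector"
  assumes s: "range s \<subseteq> {0..1}" "s \<longlonglongrightarrow> (0::real)"
  shows "(\<lambda>n. path_len (restrict (bent_path a b v (s n)) {0..1})) \<longlonglongrightarrow>
    path_len (restrict (bent_path a b v 0) {0..1})"
proof -
  have ge: "ennreal (dist a b) \<le> path_len (restrict (bent_path a b v r) {0..1})" for r
    using path_len_ge_dist[of "restrict (bent_path a b v r) {0..1}"]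
    by (simp add: bent_path_def linepath_0' linepath_1')
  have s0: "0 \<le> s n" for n
    using range_subsetD[OF s(1), of n] by simp
  have "path_len (restrict (bent_path a b v 0) {0..1}) = ennreal (dist a b)"
    using path_len_bent_path_le[of 0 a b v] ge[of 0] by (simp add: antisym)
  moreover have "(\<lambda>n. path_len (restrict (bent_path a b v (s n)) {0..1})) \<longlonglongrightarrow> ennreal (dist a b)"
  proof (rule tendsto_sandwich)
    show "(\<lambda>n. ennreal (dist a b)) \<longlonglongrightarrow> ennreal (dist a b)"
      by simp
    have "(\<lambda>n. dist a b + s n * norm v) \<longlonglongrightarrow> dist a b + 0 * norm v"
      by (intro tendsto_intros s)
    then show "(\<lambda>n. ennreal (dist a b + s n * norm v)) \<longlonglongrightarrow> ennreal (dist a b)"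
      by (simp add: tendsto_ennrealI)
  qed (intro always_eventually allI ge path_len_bent_path_le s0)+
  ultimately show ?thesis
    by simp
qed

lemma continuous_on_bent_path:
  fixes E :: "('a::real_normed_vector \<times> 'a) set"
  assumes "continuous_on E v"
  shows "continuous_on ((E \<times> {0..1}) \<times> {0..1})
    (\<lambda>((e, s), t). bent_path (fst e) (snd e) (v e) s t)"
  unfolding bent_path_def linepath_def case_prod_unfold
  by (intro continuous_intros continuous_on_compose2[OF assms]) auto

text \<open>Bending segments along a continuous field gives a near-geodesic rule as soon as the properly bent
  paths avoid the puncture. The proviso on geodesics in \<open>X\<close> comes for free, since by uniqueness such a
  geodesic can only be the segment at \<open>s = 0\<close>.\<close>
lemma NGMPR_bent_path:
  fixes x\<^sub>0 :: "'a::euclidean_space" and E :: "('a \<times> 'a) set"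
  defines "X \<equiv> UNIV - {x\<^sub>0}"
  assumes E: "E \<subseteq> X \<times> X" and v: "continuous_on E v"
    and avoid: "\<And>e s t. e \<in> E \<Longrightarrow> 0 < s \<Longrightarrow> t \<in> {0..1} \<Longrightarrow> bent_path (fst e) (snd e) (v e) s t \<noteq> x\<^sub>0"
  shows "NGMPR X E (\<lambda>e. \<lambda>s\<in>{0..1}. restrict (bent_path (fst e) (snd e) (v e) s) {0..1})"
    (is "NGMPR X E ?\<Phi>")
proof -
  have cl: "closure X = UNIV"
    unfolding X_def by (metis Compl_eq_Diff_UNIV closure_complement interior_singleton Compl_empty_eq)
  have c: "continuous_map (prod_topology (prod_topology (top_of_set E) unit_interval) unit_interval)
      (top_of_set UNIV) (\<lambda>(w, t). (\<lambda>(e, s). bent_path (fst e) (snd e) (v e) s) w t)"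
    using continuous_on_bent_path[OF v] by (simp add: case_prod_unfold)
  have c1: "continuous_map (prod_topology (top_of_set E) unit_interval) (path_space (top_of_set UNIV))
      (\<lambda>(e, s). restrict (bent_path (fst e) (snd e) (v e) s) {0..1})"
    using continuous_map_curry_path_space[OF c] by (simp add: case_prod_unfold)
  have c2: "continuous_map (top_of_set E) (path_space (path_space (top_of_set UNIV))) ?\<Phi>"
    by (rule continuous_map_curry_path_space[OF c1])
  have near: "near_geodesic X a b (?\<Phi> (a, b))" if e: "(a, b) \<in> E" for a b
  proof -
    define \<phi> where "\<phi> = ?\<Phi> (a, b)"
    have "(a, b) \<in> topspace (top_of_set E)"
      using e by simp
    then have "\<phi> \<in> topspace (path_space (path_space (top_of_set UNIV)))"
      unfolding \<phi>_def by (rule subsetD[OF continuous_map_image_subset_topspace[OF c2] imageI])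
    then have cs: "continuous_map unit_interval (path_space (top_of_set UNIV)) \<phi>"
      by (simp add: topspace_path_space)
    have sub: "\<phi> s \<in> topspace (path_space (top_of_set UNIV))" if "s \<in> {0..1}" for s
      using continuous_map_image_subset_topspace[OF cs] that by auto
    have val: "\<phi> s = restrict (bent_path a b (v (a, b)) s) {0..1}" if "s \<in> {0..1}" for s
      using that by (simp add: \<phi>_def)
    have ends: "\<phi> s 0 = a" "\<phi> s 1 = b" if "s \<in> {0..1}" for s
      by (simp_all add: val[OF that] bent_path_def linepath_0' linepath_1')
    have 1: "continuous_map unit_interval (paths_between (top_of_set UNIV) a b) \<phi>"
      unfolding paths_between_def continuous_map_in_subtopology using cs ends by auto
    have "\<phi> 0 = restrict (linepath a b) {0..1}"
      by (simp add: val bent_path_def[abs_def])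
    then have 2: "geodesic UNIV a b (\<phi> 0)"
      by (simp only: geodesic_linepath subset_UNIV)
    have 3: "\<phi> ` {0<..1} \<subseteq> topspace (paths_between (top_of_set X) a b)"
    proof (rule image_subsetI)
      fix s :: real assume s: "s \<in> {0<..1}"
      then have s01: "s \<in> {0..1}"
        by simp
      have "\<phi> s t \<in> X" if "t \<in> {0..1}" for t
        using avoid[OF e, of s t] s that by (simp add: X_def val[OF s01])
      then show "\<phi> s \<in> topspace (paths_between (top_of_set X) a b)"
        using sub[OF s01] ends[OF s01]
        by (simp add: paths_between_def topspace_path_space continuous_map_in_subtopology image_subset_iff Pi_iff)
    qed
    have 4: "(\<lambda>n. path_len (\<phi> (s n))) \<longlonglongrightarrow> path_len (\<phi> 0)"
      if "range s \<subseteq> {0..1}" "s \<longlonglongrightarrow> 0" for s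
      using path_len_bent_path_tendsto[OF that, of a b "v (a, b)"]
      by (simp add: val range_subsetD[OF that(1), simplified])
    show ?thesis
      unfolding near_geodesic_def cl \<phi>_def[symmetric] using 1 2 3 4 by blast
  qed
  have geo: "geodesic X a b (?\<Phi> (a, b) 0)" if "geodesic X a b \<gamma>" for a b \<gamma>
  proof -
    have "linepath a b ` {0..1} \<subseteq> X"
    proof (rule image_subsetI)
      fix t :: real assume t: "t \<in> {0..1}"
      then have "\<gamma> t \<in> X"
        using that by (auto simp: geodesic_def paths_between_def topspace_path_space
            continuous_map_in_subtopology)
      then show "linepath a b t \<in> X"
        by (simp only: geodesic_eq_linepath[OF that t])
    qed
    from geodesic_linepath[OF this] show ?thesis
      by (simp add: bent_path_def[abs_def])
  qed
  show ?thesis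
    unfolding NGMPR_def cl
  proof (intro conjI ballI c2)
    fix e assume "e \<in> E"
    then show "case e of (a, b) \<Rightarrow> near_geodesic X a b (?\<Phi> (a, b)) \<and>
        ((\<exists>\<gamma>. geodesic X a b \<gamma>) \<longrightarrow> geodesic X a b (?\<Phi> (a, b) 0))"
      unfolding case_prod_unfold using near[of "fst e" "snd e"] geo[of "fst e" "snd e"]
      unfolding prod.collapse by blast
  qed
qed

lemma NGMPR_straight:
  fixes x\<^sub>0 :: "'a::euclidean_space" and E :: "('a \<times> 'a) set"
  assumes E: "E \<subseteq> (UNIV - {x\<^sub>0}) \<times> (UNIV - {x\<^sub>0})"
    and seg: "\<And>a b. (a, b) \<in> E \<Longrightarrow> x\<^sub>0 \<notin> closed_segment a b"
  shows "\<exists>\<Phi>. NGMPR (UNIV - {x\<^sub>0}) E \<Phi>"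
proof -
  have "bent_path (fst e) (snd e) 0 s t \<noteq> x\<^sub>0" if "e \<in> E" "t \<in> {0..1}" for e s t
    using seg[of "fst e" "snd e"] linepath_in_path[OF that(2), of "fst e" "snd e"] that(1)
    by (auto simp: bent_path_def)
  then show ?thesis
    by (intro exI) (rule NGMPR_bent_path[OF E continuous_on_const])
qed

text \<open>As \<open>x\<^sub>0\<close> lies on the segment, both \<open>a - x\<^sub>0\<close> and \<open>b - x\<^sub>0\<close> are orthogonal to \<open>v\<close>. A bent path that
  meets \<open>x\<^sub>0\<close> must therefore do so with zero \<open>v\<close>-component, which happens only at its end points.\<close>
lemma NGMPR_perpendicular:
  fixes x\<^sub>0 :: "'a::euclidean_space" and E :: "('a \<times> 'a) set"
  assumes E: "E \<subseteq> (UNIV - {x\<^sub>0}) \<times> (UNIV - {x\<^sub>0})"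
    and seg: "\<And>a b. (a, b) \<in> E \<Longrightarrow> x\<^sub>0 \<in> closed_segment a b"
    and v: "continuous_on E v" "\<And>e. e \<in> E \<Longrightarrow> v e \<noteq> 0" "\<And>e. e \<in> E \<Longrightarrow> v e \<bullet> (fst e - x\<^sub>0) = 0"
  shows "\<exists>\<Phi>. NGMPR (UNIV - {x\<^sub>0}) E \<Phi>"
proof -
  have "bent_path a b (v (a, b)) s t \<noteq> x\<^sub>0" if e: "(a, b) \<in> E" and s: "0 < s" and t: "t \<in> {0..1}" for a b s t
  proof
    assume eq: "bent_path a b (v (a, b)) s t = x\<^sub>0"
    have ab: "a \<noteq> x\<^sub>0" "b \<noteq> x\<^sub>0"
      using E e by auto
    \<comment> \<open>Then \<open>b - x\<^sub>0\<close> is a multiple of \<open>a - x\<^sub>0\<close>, and \<open>v\<close> is orthogonal to both.\<close>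
    obtain u where u: "x\<^sub>0 = (1 - u) *\<^sub>R a + u *\<^sub>R b"
      using seg[OF e] unfolding in_segment by blast
    then have "u \<noteq> 0"
      using ab(1) by auto
    have "u *\<^sub>R (b - x\<^sub>0) = - ((1 - u) *\<^sub>R (a - x\<^sub>0))"
      by (simp add: u algebra_simps)
    then have "u * (v (a, b) \<bullet> (b - x\<^sub>0)) = - ((1 - u) * (v (a, b) \<bullet> (a - x\<^sub>0)))"
      by (metis inner_minus_right inner_scaleR_right)
    then have vb: "v (a, b) \<bullet> (b - x\<^sub>0) = 0"
      using v(3)[OF e] \<open>u \<noteq> 0\<close> by simp
    have "0 = (1 - t) *\<^sub>R (a - x\<^sub>0) + t *\<^sub>R (b - x\<^sub>0) + (s * (t * (1 - t))) *\<^sub>R v (a, b)"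
      using eq by (simp add: bent_path_def linepath_def algebra_simps)
    then have "0 = v (a, b) \<bullet> ((1 - t) *\<^sub>R (a - x\<^sub>0) + t *\<^sub>R (b - x\<^sub>0) + (s * (t * (1 - t))) *\<^sub>R v (a, b))"
      by simp
    also have "\<dots> = (s * (t * (1 - t))) * (v (a, b) \<bullet> v (a, b))"
      using v(3)[OF e] vb by (simp add: inner_add_right)
    finally have "t = 0 \<or> t = 1"
      using v(2)[OF e] s by auto
    then show False
      using eq ab by (auto simp: bent_path_def linepath_0' linepath_1')
  qed
  then have "\<And>e s t. e \<in> E \<Longrightarrow> 0 < s \<Longrightarrow> t \<in> {0..1} \<Longrightarrow> bent_path (fst e) (snd e) (v e) s t \<noteq> x\<^sub>0"
    by (metis prod.collapse)
  then show ?thesis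
    by (intro exI) (rule NGMPR_bent_path[OF E v(1)])
qed

text \<open>A complex structure: the basis is split into halves \<open>B\<close> and \<open>c ` B\<close>, and \<open>J\<close> rotates each plane
  spanned by \<open>u\<close> and \<open>c u\<close> by a right angle.\<close>
lemma orthogonal_field_even_DIM:
  assumes "even DIM('a::euclidean_space)"
  obtains J :: "'a::euclidean_space \<Rightarrow> 'a" where "continuous_on UNIV J" "\<And>x. J x \<bullet> x = 0" "\<And>x. x \<noteq> 0 \<Longrightarrow> J x \<noteq> 0"
proof -
  obtain m where m: "DIM('a) = m + m"
    using assms by (metis evenE mult_2)
  have "m \<le> card (Basis :: 'a set)"
    using m by simp
  then obtain B where B: "B \<subseteq> (Basis :: 'a set)" "card B = m" and "finite B"
    by (rule obtain_subset_with_card_n)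
  have "card (Basis - B) = m"
    using B m \<open>finite B\<close> by (simp add: card_Diff_subset)
  then have "\<exists>c. bij_betw c B (Basis - B)"
    by (intro finite_same_card_bij) (simp_all add: \<open>finite B\<close> B(2))
  then obtain c where c: "bij_betw c B (Basis - B)" ..
  have cB: "c u \<in> Basis" "c u \<notin> B" if "u \<in> B" for u
    using c that by (auto simp: bij_betw_def)
  have uc: "u \<bullet> k = (if u = k then 1 else 0)" "c u \<bullet> c k = (if u = k then 1 else 0)"
    "u \<bullet> c k = 0" "c u \<bullet> k = 0" if "u \<in> B" "k \<in> B" for u k
  proof -
    have "u \<in> Basis" "k \<in> Basis" "c u \<in> Basis" "c k \<in> Basis" "c u \<noteq> k" "u \<noteq> c k"
      using that B(1) cB by blast+
    moreover have "c u = c k \<longleftrightarrow> u = k"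
      using c that by (auto simp: bij_betw_def inj_on_def)
    ultimately show "u \<bullet> k = (if u = k then 1 else 0)" "c u \<bullet> c k = (if u = k then 1 else 0)"
      "u \<bullet> c k = 0" "c u \<bullet> k = 0"
      by (simp_all add: inner_Basis)
  qed
  \<comment> \<open>Multiplication by \<open>i\<close>, with \<open>c u\<close> in the role of \<open>i u\<close>.\<close>
  define J where "J = (\<lambda>x. \<Sum>u\<in>B. (x \<bullet> u) *\<^sub>R c u - (x \<bullet> c u) *\<^sub>R u)"
  show thesis
  proof
    show "continuous_on UNIV J"
      unfolding J_def by (intro continuous_intros)
    show "J x \<bullet> x = 0" for x
      unfolding J_def inner_sum_left
      by (rule sum.neutral) (simp only: inner_diff_left inner_scaleR_left, simp add: inner_commute)
    show "J x \<noteq> 0" if "x \<noteq> 0" for x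
    proof
      assume 0: "J x = 0"
      have 1: "x \<bullet> c k = 0" and 2: "x \<bullet> k = 0" if "k \<in> B" for k
      proof -
        have "J x \<bullet> k = (\<Sum>u\<in>B. if u = k then - (x \<bullet> c u) else 0)"
          unfolding J_def inner_sum_left
          by (rule sum.cong) (use that uc in \<open>auto simp: inner_diff_left\<close>)
        then show "x \<bullet> c k = 0"
          using that 0 \<open>finite B\<close> by simp
        have "J x \<bullet> c k = (\<Sum>u\<in>B. if u = k then x \<bullet> u else 0)"
          unfolding J_def inner_sum_left
          by (rule sum.cong) (use that uc in \<open>auto simp: inner_diff_left\<close>)
        then show "x \<bullet> k = 0"
          using that 0 \<open>finite B\<close> by simp
      qed
      have "x \<bullet> k = 0" if "k \<in> Basis" for k
      proof (cases "k \<in> B")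
        case False
        then have "k \<in> c ` B"
          using c that by (simp add: bij_betw_def)
        then obtain u where "u \<in> B" "k = c u"
          by blast
        then show ?thesis
          using 1 by simp
      qed (rule 2)
      then show False
        using \<open>x \<noteq> 0\<close> by (metis euclidean_all_zero_iff)
    qed
  qed
qed

text \<open>The set \<open>S\<close> of pairs whose segment contains \<open>x\<^sub>0\<close> is closed, so every piece below is the
  intersection of a closed and an open set and hence locally compact.\<close>
lemma GC_punctured_le:
  fixes x\<^sub>0 :: "'a::euclidean_space"
  assumes "2 \<le> DIM('a)"
  shows "GC (UNIV - {x\<^sub>0}) \<le> (if even DIM('a) then 1 else 2)"
proof -
  define X where "X = UNIV - {x\<^sub>0}"
  define S where "S = {e. dist (fst e) (snd e) = dist (fst e) x\<^sub>0 + dist x\<^sub>0 (snd e)}"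
  have S: "(a, b) \<in> S \<longleftrightarrow> x\<^sub>0 \<in> closed_segment a b" for a b
    by (simp add: S_def flip: between between_mem_segment)
  have "closed S"
    unfolding S_def by (intro closed_Collect_eq continuous_intros)
  have "open X"
    by (simp add: X_def open_delete)
  then have "open (X \<times> X)"
    by (simp add: open_Times)
  have lc: "locally_compact_space (subtopology (prod_topology (top_of_set X) (top_of_set X)) (C \<inter> W))"
    if "closed C" "open W" "C \<inter> W \<subseteq> X \<times> X" for C W
    unfolding subtopology_prod_top_of_set[OF that(3)] locally_compact_space_top_of_set_iff
      locally_compact_closed_Int_open using that by blast
  \<comment> \<open>Written as a closed set intersected with an open one, to match \<open>lc\<close>.\<close>
  define E\<^sub>0 where "E\<^sub>0 = UNIV \<inter> (X \<times> X \<inter> - S)"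
  have lc0: "locally_compact_space (subtopology (prod_topology (top_of_set X) (top_of_set X)) E\<^sub>0)"
    unfolding E\<^sub>0_def
    by (intro lc closed_UNIV open_Int open_Compl \<open>closed S\<close> \<open>open (X \<times> X)\<close>) blast
  have rule0: "\<exists>\<Phi>. NGMPR X E\<^sub>0 \<Phi>"
    unfolding X_def by (rule NGMPR_straight) (auto simp: E\<^sub>0_def S X_def)
  show ?thesis
  proof (cases "even DIM('a)")
    case True
    then obtain J :: "'a \<Rightarrow> 'a" where J: "continuous_on UNIV J" "\<And>x. J x \<bullet> x = 0" "\<And>x. x \<noteq> 0 \<Longrightarrow> J x \<noteq> 0"
      using orthogonal_field_even_DIM by blast
    define E\<^sub>1 where "E\<^sub>1 = S \<inter> X \<times> X"
    have lc1: "locally_compact_space (subtopology (prod_topology (top_of_set X) (top_of_set X)) E\<^sub>1)"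
      unfolding E\<^sub>1_def by (intro lc \<open>closed S\<close> \<open>open (X \<times> X)\<close>) auto
    have rule1: "\<exists>\<Phi>. NGMPR X E\<^sub>1 \<Phi>"
      unfolding X_def
    proof (rule NGMPR_perpendicular[where v = "\<lambda>e. J (fst e - x\<^sub>0)"])
      show "continuous_on E\<^sub>1 (\<lambda>e. J (fst e - x\<^sub>0))"
        by (rule continuous_on_compose2[OF J(1)]) (auto intro!: continuous_intros)
    qed (use J in \<open>auto simp: E\<^sub>1_def X_def S\<close>)
    have "GC X \<le> enat 1"
      unfolding GC_def
    proof (rule partition_complexity_le[where E = "\<lambda>i. if i = 0 then E\<^sub>0 else E\<^sub>1"])
      show "disjoint_family_on (\<lambda>i. if i = 0 then E\<^sub>0 else E\<^sub>1) {..1::nat}"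
        by (auto simp: disjoint_family_on_def E\<^sub>0_def E\<^sub>1_def)
      show "(\<Union>i\<le>1::nat. if i = 0 then E\<^sub>0 else E\<^sub>1) = topspace (top_of_set X) \<times> topspace (top_of_set X)"
        by (auto simp: atMost_Suc E\<^sub>0_def E\<^sub>1_def)
      show "locally_compact_space (subtopology (prod_topology (top_of_set X) (top_of_set X)) (if i = 0 then E\<^sub>0 else E\<^sub>1))"
        "\<exists>\<Phi>. NGMPR X (if i = 0 then E\<^sub>0 else E\<^sub>1) \<Phi>" for i :: nat
        by (simp_all only: lc0 lc1 rule0 rule1 simp_thms split: if_split)
    qed
    with True show ?thesis
      by (simp add: X_def one_enat_def)
  next
    case False
    obtain u :: 'a where u: "u \<in> Basis"
      using nonempty_Basis by blast
    have "card (Basis - {u}) \<noteq> 0"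
      using assms u by simp
    then obtain w where w: "w \<in> Basis" "w \<noteq> u"
      by (metis DiffE card.empty ex_in_conv insertI1)
    have uw: "u \<bullet> w = 0" "w \<bullet> u = 0" "u \<noteq> 0" "w \<noteq> 0"
      using u w by (auto simp: inner_Basis)
    \<comment> \<open>Up to the factor \<open>\<bar>fst e - x\<^sub>0\<bar>\<^sup>2\<close>, the part of \<open>u\<close> that is orthogonal to \<open>fst e - x\<^sub>0\<close>. The
      factor makes it continuous also at \<open>fst e = x\<^sub>0\<close>.\<close>
    define p where "p e = ((fst e - x\<^sub>0) \<bullet> (fst e - x\<^sub>0)) *\<^sub>R u - (u \<bullet> (fst e - x\<^sub>0)) *\<^sub>R (fst e - x\<^sub>0)"
      for e :: "'a \<times> 'a"
    have p: "continuous_on A p" for A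
      unfolding p_def by (intro continuous_intros)
    have "((d \<bullet> d) *\<^sub>R u - (u \<bullet> d) *\<^sub>R d) \<bullet> d = 0" for d
      by (simp add: inner_diff_left)
    then have p_perp: "p e \<bullet> (fst e - x\<^sub>0) = 0" for e
      unfolding p_def .
    \<comment> \<open>If \<open>p\<close> vanishes, then \<open>fst e - x\<^sub>0\<close> is a multiple of \<open>u\<close>.\<close>
    have w_perp: "w \<bullet> (fst e - x\<^sub>0) = 0" if "p e = 0" "fst e \<noteq> x\<^sub>0" for e
    proof -
      have "u \<bullet> (fst e - x\<^sub>0) \<noteq> 0"
        using that uw by (auto simp: p_def)
      moreover have "w \<bullet> p e = - (u \<bullet> (fst e - x\<^sub>0)) * (w \<bullet> (fst e - x\<^sub>0))"
        by (simp only: p_def inner_diff_right inner_scaleR_right uw)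
      ultimately show ?thesis
        using that(1) by simp
    qed
    define E\<^sub>1 where "E\<^sub>1 = S \<inter> (X \<times> X \<inter> {e. p e \<noteq> 0})"
    define E\<^sub>2 where "E\<^sub>2 = (S \<inter> {e. p e = 0}) \<inter> X \<times> X"
    have lc1: "locally_compact_space (subtopology (prod_topology (top_of_set X) (top_of_set X)) E\<^sub>1)"
      unfolding E\<^sub>1_def
      by (intro lc \<open>closed S\<close> open_Int \<open>open (X \<times> X)\<close> open_Collect_neq p continuous_on_const) auto
    have lc2: "locally_compact_space (subtopology (prod_topology (top_of_set X) (top_of_set X)) E\<^sub>2)"
      unfolding E\<^sub>2_def
      by (intro lc closed_Int \<open>closed S\<close> \<open>open (X \<times> X)\<close> closed_Collect_eq p continuous_on_const) auto
    have rule1: "\<exists>\<Phi>. NGMPR X E\<^sub>1 \<Phi>"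
      unfolding X_def
      by (rule NGMPR_perpendicular[where v = p]) (use p_perp in \<open>auto simp: E\<^sub>1_def X_def S intro: p\<close>)
    have rule2: "\<exists>\<Phi>. NGMPR X E\<^sub>2 \<Phi>"
      unfolding X_def
      by (rule NGMPR_perpendicular[where v = "\<lambda>_. w"]) (use w_perp uw in \<open>auto simp: E\<^sub>2_def X_def S\<close>)
    let ?E = "\<lambda>i::nat. if i = 0 then E\<^sub>0 else if i = 1 then E\<^sub>1 else E\<^sub>2"
    have "GC X \<le> enat 2"
      unfolding GC_def
    proof (rule partition_complexity_le[where E = ?E])
      show "disjoint_family_on ?E {..2}"
        by (auto simp: disjoint_family_on_def E\<^sub>0_def E\<^sub>1_def E\<^sub>2_def)
      show "(\<Union>i\<le>2. ?E i) = topspace (top_of_set X) \<times> topspace (top_of_set X)"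
        by (auto simp: numeral_2_eq_2 atMost_Suc E\<^sub>0_def E\<^sub>1_def E\<^sub>2_def)
      show "locally_compact_space (subtopology (prod_topology (top_of_set X) (top_of_set X)) (?E i))"
        "\<exists>\<Phi>. NGMPR X (?E i) \<Phi>" for i
        by (simp_all only: lc0 lc1 lc2 rule0 rule1 rule2 simp_thms split: if_split)
    qed
    with False show ?thesis
      by (simp add: X_def numeral_eq_enat)
  qed
qed

section \<open>Degrees of coordinate reflections\<close>

definition reflect :: "nat set \<Rightarrow> (nat \<Rightarrow> real) \<Rightarrow> nat \<Rightarrow> real" where
  "reflect J x i = (if i \<in> J then - x i else x i)"

lemma continuous_map_nsphere_reflect: "continuous_map (nsphere p) (nsphere p) (reflect J)"
proof -
  have sq: "(reflect J x i)\<^sup>2 = (x i)\<^sup>2" for x i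
    by (simp add: reflect_def)
  have "continuous_map (nsphere p) euclideanreal (\<lambda>x. reflect J x i)" for i
    unfolding reflect_def by (cases "i \<in> J") (auto intro: continuous_intros continuous_map_nsphere_projection)
  then have "continuous_map (nsphere p) (powertop_real UNIV) (reflect J)"
    by (simp add: continuous_map_componentwise_UNIV)
  then show ?thesis
    unfolding nsphere[of p] continuous_map_in_subtopology
    by (auto simp: sq nsphere) (simp add: reflect_def)
qed

lemma continuous_map_nsphere_transpose:
  assumes "j \<le> p"
  shows "continuous_map (nsphere p) (nsphere p) (\<lambda>x. x \<circ> Transposition.transpose 0 j)"
proof -
  have "(\<Sum>i\<le>p. (x (Transposition.transpose 0 j i))\<^sup>2) = (\<Sum>i\<le>p. (x i)\<^sup>2)" for x :: "nat \<Rightarrow> real"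
    by (rule sum.reindex_bij_witness[where i="Transposition.transpose 0 j" and j="Transposition.transpose 0 j"])
      (use assms in \<open>auto simp: Transposition.transpose_def\<close>)
  moreover have "continuous_map (nsphere p) (powertop_real UNIV) (\<lambda>x. x \<circ> Transposition.transpose 0 j)"
    by (simp add: continuous_map_componentwise_UNIV continuous_map_nsphere_projection)
  ultimately show ?thesis
    unfolding nsphere[of p] continuous_map_in_subtopology
    using assms by (auto simp: nsphere Transposition.transpose_def)
qed

text \<open>Conjugation with a transposition of coordinates reduces this to the reflection in coordinate 0. The
  transposition is an involution, so the square of its degree is 1.\<close>
lemma Brouwer_degree2_reflect_one:
  assumes "j \<le> p"
  shows "Brouwer_degree2 p (reflect {j}) = -1"
proof -
  let ?\<tau> = "\<lambda>x::nat \<Rightarrow> real. x \<circ> Transposition.transpose 0 j"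
  note cont = continuous_map_nsphere_transpose[OF assms] continuous_map_nsphere_reflect
  have "Brouwer_degree2 p (?\<tau> \<circ> ?\<tau>) = 1"
    using Brouwer_degree2_id[of p] by (simp add: comp_def id_def)
  then have sq: "Brouwer_degree2 p ?\<tau> * Brouwer_degree2 p ?\<tau> = 1"
    by (simp only: Brouwer_degree2_compose cont)
  have "reflect {j} = ?\<tau> \<circ> (reflect {0} \<circ> ?\<tau>)"
    by (auto simp: fun_eq_iff reflect_def Transposition.transpose_def)
  then have "Brouwer_degree2 p (reflect {j}) =
      Brouwer_degree2 p ?\<tau> * (Brouwer_degree2 p (reflect {0}) * Brouwer_degree2 p ?\<tau>)"
    by (simp only: Brouwer_degree2_compose cont continuous_map_compose[OF cont])
  moreover have "reflect {0} = (\<lambda>x i. if i = 0 then - x i else x i)"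
    by (auto simp: fun_eq_iff reflect_def)
  ultimately show ?thesis
    using sq by (simp add: Brouwer_degree2_reflection)
qed

lemma Brouwer_degree2_reflect:
  assumes "J \<subseteq> {..p}"
  shows "Brouwer_degree2 p (reflect J) = (-1) ^ card J"
proof -
  have "finite J"
    using assms finite_subset by blast
  then show ?thesis
    using assms
  proof induction
    case empty
    have "reflect {} = id"
      by (auto simp: fun_eq_iff reflect_def)
    then show ?case
      by (simp only: Brouwer_degree2_id card.empty power_0)
  next
    case (insert j J)
    have "reflect (insert j J) = reflect {j} \<circ> reflect J"
      using insert.hyps by (auto simp: fun_eq_iff reflect_def)
    then have "Brouwer_degree2 p (reflect (insert j J)) =
        Brouwer_degree2 p (reflect {j}) * Brouwer_degree2 p (reflect J)"
      by (simp only: Brouwer_degree2_compose continuous_map_nsphere_reflect)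
    then show ?case
      using insert by (simp add: Brouwer_degree2_reflect_one)
  qed
qed

text \<open>An enumeration of the basis identifies the unit sphere with \<open>nsphere p\<close>. Normalised values turn a
  homotopy into the punctured space into one of self-maps of \<open>nsphere p\<close>, whose ends have degrees \<open>1\<close>
  and \<open>(- 1) ^ card J\<close>.\<close>
lemma even_card_reflected_basis:
  fixes J :: "'a::euclidean_space set"
  assumes J: "J \<subseteq> Basis"
    and hom: "homotopic_with_canon (\<lambda>_. True) (sphere 0 1) (- {0})
      id (\<lambda>z::'a. z - 2 *\<^sub>R (\<Sum>b\<in>J. (z \<bullet> b) *\<^sub>R b))"
  shows "even (card J)"
proof -
  define p where "p = DIM('a) - 1"
  have p: "{..p} = {..<DIM('a)}"
    using DIM_positive[where 'a='a] unfolding p_def set_eq_iff atMost_iff lessThan_iff by linarith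
  obtain b where b: "bij_betw b {..p} (Basis :: 'a set)"
    using ex_bij_betw_nat_finite[of "Basis :: 'a set"] unfolding p lessThan_atLeast0 by auto
  have bB: "b i \<in> Basis" if "i \<le> p" for i
    using that b by (auto simp: bij_betw_def)
  have binner: "b i \<bullet> b j = (if i = j then 1 else 0)" if "i \<le> p" "j \<le> p" for i j
    using that bB[of i] bB[of j] b by (auto simp: bij_betw_def inj_on_def inner_Basis)
  define U where "U x = (\<Sum>i\<le>p. x i *\<^sub>R b i)" for x :: "nat \<Rightarrow> real"
  define T where "T z i = (if i \<le> p then (z \<bullet> b i) / norm z else 0)" for z :: 'a and i
  have Ub: "U x \<bullet> b j = x j" if "j \<le> p" for x j
  proof -
    have "U x \<bullet> b j = (\<Sum>i\<le>p. if i = j then x i else 0)"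
      unfolding U_def inner_sum_left by (rule sum.cong) (use that binner in auto)
    then show ?thesis
      using that by simp
  qed
  have nsq: "(\<Sum>i\<le>p. (z \<bullet> b i)\<^sup>2) = (norm z)\<^sup>2" for z
  proof -
    have "(\<Sum>i\<le>p. (z \<bullet> b i)\<^sup>2) = (\<Sum>v\<in>Basis. (z \<bullet> v)\<^sup>2)"
      by (rule sum.reindex_bij_betw[OF b])
    then show ?thesis
      by (simp add: norm_eq_sqrt_inner euclidean_inner[of z z] power2_eq_square sum_nonneg)
  qed
  have nU: "norm (U x) = 1" if "x \<in> topspace (nsphere p)" for x
  proof -
    have "(norm (U x))\<^sup>2 = 1"
      using that nsq[of "U x"] by (simp add: Ub nsphere)
    then show ?thesis
      by (smt (verit) norm_ge_zero power2_eq_1_iff)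
  qed
  have contU: "continuous_map (nsphere p) (top_of_set (sphere 0 1)) U"
  proof -
    have "continuous_map (nsphere p) euclidean (\<lambda>x. x i *\<^sub>R b i)" for i
      using continuous_map_compose[OF continuous_map_nsphere_projection[of p i],
          of euclidean "\<lambda>r. r *\<^sub>R b i"]
      by (simp add: o_def continuous_intros)
    then have "continuous_map (nsphere p) euclidean U"
      unfolding U_def by (intro continuous_map_sum) auto
    then show ?thesis
      using nU by (auto simp: continuous_map_in_subtopology)
  qed
  have contT: "continuous_map (top_of_set (- {0})) (nsphere p) T"
  proof -
    have "continuous_map (top_of_set (- {0})) euclideanreal (\<lambda>z. T z i)" for i
      by (auto simp: T_def intro!: continuous_intros)
    moreover have "(\<Sum>i\<le>p. (T z i)\<^sup>2) = 1" if "z \<noteq> 0" for z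
      using that by (simp add: T_def power_divide nsq flip: sum_divide_distrib)
    ultimately show ?thesis
      unfolding nsphere[of p] continuous_map_in_subtopology
      by (auto simp: continuous_map_componentwise_UNIV T_def)
  qed
  define I where "I = {i. i \<le> p \<and> b i \<in> J}"
  have bI: "bij_betw b I J"
    using b J by (auto simp: bij_betw_def I_def inj_on_def)
  have TU: "T (U x) = x" if "x \<in> topspace (nsphere p)" for x
    using that by (auto simp: T_def nU Ub fun_eq_iff nsphere)
  have refl: "T (U x - 2 *\<^sub>R (\<Sum>v\<in>J. (U x \<bullet> v) *\<^sub>R v)) = reflect I x"
    if x: "x \<in> topspace (nsphere p)" for x
  proof -
    have "(\<Sum>v\<in>J. (U x \<bullet> v) *\<^sub>R v) = (\<Sum>i\<in>I. x i *\<^sub>R b i)"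
      by (subst sum.reindex_bij_betw[OF bI, symmetric]) (auto simp: I_def Ub intro!: sum.cong)
    also have "\<dots> = (\<Sum>i\<le>p. (if i \<in> I then x i else 0) *\<^sub>R b i)"
      by (rule sum.mono_neutral_cong_left) (auto simp: I_def)
    finally have "U x - 2 *\<^sub>R (\<Sum>v\<in>J. (U x \<bullet> v) *\<^sub>R v) = U (reflect I x)"
      by (simp add: U_def reflect_def scaleR_sum_right flip: sum_subtractf scaleR_diff_left)
        (rule sum.cong; auto simp: mult_2_right scaleR_add_left)
    then show ?thesis
      using TU continuous_map_image_subset_topspace[OF continuous_map_nsphere_reflect] x
      by (metis image_subset_iff)
  qed
  have "homotopic_with (\<lambda>_. True) (nsphere p) (nsphere p)
     (T \<circ> (id \<circ> U)) (T \<circ> ((\<lambda>z. z - 2 *\<^sub>R (\<Sum>b\<in>J. (z \<bullet> b) *\<^sub>R b)) \<circ> U))"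
    by (intro homotopic_with_compose_continuous_map_left[OF _ contT]
        homotopic_with_compose_continuous_map_right[OF hom contU]) auto
  then have "homotopic_with (\<lambda>_. True) (nsphere p) (nsphere p) id (reflect I)"
    by (rule homotopic_with_eq) (auto simp: TU refl)
  then have "(-1 :: int) ^ card I = 1"
    using Brouwer_degree2_homotopic Brouwer_degree2_reflect[of I p] by (force simp: I_def)
  then show ?thesis
    using bij_betw_same_card[OF bI] by (metis neg_one_odd_power one_neq_neg_one)
qed

section \<open>From two sections to two deformations\<close>

text \<open>A section over a locally compact, hence locally closed, set extends to a neighbourhood: the Tietze
  theorem extends it together with the prescribed end points, and by compactness of the interval the
  extension still avoids 0 near \<open>E\<close>.\<close>
lemma section_extends_to_neighbourhood:
  fixes Y E :: "'b::euclidean_space set" and p q :: "'b \<Rightarrow> 'a::euclidean_space"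
  assumes E: "locally compact E" "E \<subseteq> Y"
    and pq: "continuous_on Y p" "continuous_on Y q"
    and \<sigma>: "continuous_on (E \<times> {0..1}) (\<lambda>(e, t). \<sigma> e t)"
      "\<And>e t. e \<in> E \<Longrightarrow> t \<in> {0..1::real} \<Longrightarrow> \<sigma> e t \<noteq> 0"
      "\<And>e. e \<in> E \<Longrightarrow> \<sigma> e 0 = p e" "\<And>e. e \<in> E \<Longrightarrow> \<sigma> e 1 = q e"
  obtains V \<tau> where "openin (top_of_set Y) V" "E \<subseteq> V" "continuous_on (V \<times> {0..1}) (\<lambda>(e, t). \<tau> e t)"
      "\<And>e t. e \<in> V \<Longrightarrow> t \<in> {0..1::real} \<Longrightarrow> \<tau> e t \<noteq> 0"
      "\<And>e. e \<in> V \<Longrightarrow> \<tau> e 0 = p e" "\<And>e. e \<in> V \<Longrightarrow> \<tau> e 1 = q e"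
proof -
  obtain C W where CW: "closed C" "open W" "E = C \<inter> W"
    using E(1) unfolding locally_compact_closed_Int_open by blast
  define U where "U = W \<inter> Y"
  have U: "openin (top_of_set Y) U"
    unfolding U_def using CW(2) by (metis Int_commute openin_open_Int)
  have EU: "E \<subseteq> U"
    using E(2) CW(3) by (auto simp: U_def)
  have cpq: "continuous_on U p" "continuous_on U q"
    using pq by (auto simp: U_def intro: continuous_on_subset)
  \<comment> \<open>The section and the end points, glued on a closed part of \<open>U \<times> {0..1}\<close>.\<close>
  define h where "h = (\<lambda>(e, t). if t = 0 then p e else if t = 1 then q e else \<sigma> e t)"
  let ?D0 = "E \<times> {0..1}" and ?D1 = "U \<times> {0::real}" and ?D2 = "U \<times> {1::real}"
  have cl: "closedin (top_of_set (U \<times> {0..1})) (E \<times> {0..1::real})"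
    "closedin (top_of_set (U \<times> {0..1})) (U \<times> {0::real})"
    "closedin (top_of_set (U \<times> {0..1})) (U \<times> {1::real})"
  proof -
    have "E \<times> {0..1::real} = (U \<times> {0..1}) \<inter> (C \<times> UNIV)"
      using CW EU by (auto simp: U_def)
    then show "closedin (top_of_set (U \<times> {0..1})) (E \<times> {0..1::real})"
      using CW(1) by (metis closed_Times closed_UNIV closedin_closed_Int)
    have "U \<times> {0::real} = (U \<times> {0..1}) \<inter> (UNIV \<times> {0})" "U \<times> {1::real} = (U \<times> {0..1}) \<inter> (UNIV \<times> {1})"
      by auto
    then show "closedin (top_of_set (U \<times> {0..1})) (U \<times> {0::real})"
      "closedin (top_of_set (U \<times> {0..1})) (U \<times> {1::real})"
      by (metis closed_Times closed_UNIV closed_singleton closedin_closed_Int)+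
  qed
  have h: "continuous_on ?D0 h" "continuous_on ?D1 h" "continuous_on ?D2 h"
  proof -
    show "continuous_on ?D0 h"
      by (rule continuous_on_eq[OF \<sigma>(1)]) (use \<sigma>(3,4) in \<open>auto simp: h_def\<close>)
    have h12: "continuous_on ?D1 (\<lambda>z. p (fst z))" "continuous_on ?D2 (\<lambda>z. q (fst z))"
      by (auto intro!: continuous_on_compose2[OF cpq(1)] continuous_on_compose2[OF cpq(2)]
          continuous_intros)
    show "continuous_on ?D1 h" "continuous_on ?D2 h"
      by (rule continuous_on_eq[OF h12(1)] continuous_on_eq[OF h12(2)]; force simp: h_def)+
  qed
  have "continuous_on (?D0 \<union> (?D1 \<union> ?D2)) h"
  proof (intro continuous_on_Un_local h)
    have D: "?D0 \<union> (?D1 \<union> ?D2) \<subseteq> U \<times> {0..1}"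
      using EU by auto
    show "closedin (top_of_set (?D0 \<union> (?D1 \<union> ?D2))) ?D0"
      by (rule closedin_subset_trans[OF cl(1) _ D]) auto
    show "closedin (top_of_set (?D0 \<union> (?D1 \<union> ?D2))) (?D1 \<union> ?D2)"
      by (rule closedin_subset_trans[OF closedin_Un[OF cl(2,3)] _ D]) auto
    show "closedin (top_of_set (?D1 \<union> ?D2)) ?D1"
      by (rule closedin_subset_trans[OF cl(2)]) auto
    show "closedin (top_of_set (?D1 \<union> ?D2)) ?D2"
      by (rule closedin_subset_trans[OF cl(3)]) auto
  qed
  moreover have "closedin (top_of_set (U \<times> {0..1})) (?D0 \<union> (?D1 \<union> ?D2))"
    by (intro closedin_Un cl)
  ultimately obtain g where g: "continuous_on (U \<times> {0..1}) g" and gh: "\<And>z. z \<in> ?D0 \<union> (?D1 \<union> ?D2) \<Longrightarrow> g z = h z"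
    by (rule Tietze_unbounded[where S="?D0 \<union> (?D1 \<union> ?D2)" and U="U \<times> {0..1}"]) blast
  define Z where "Z = fst ` {z \<in> U \<times> {0..1}. g z = 0}"
  have "closedin (top_of_set U) Z"
    unfolding Z_def
    by (intro Starlike.closed_map_fst[of "{0..1}"] continuous_closedin_preimage_constant g) auto
  then have "openin (top_of_set U) (U - Z)"
    by (simp add: openin_diff)
  show thesis
  proof
    show "openin (top_of_set Y) (U - Z)"
      using \<open>openin (top_of_set U) (U - Z)\<close> U openin_trans by blast
    show "E \<subseteq> U - Z"
    proof -
      have "g (e, t) = \<sigma> e t" if "e \<in> E" "t \<in> {0..1}" for e t
        using gh[of "(e, t)"] \<sigma>(3,4)[OF that(1)] that by (auto simp: h_def)
      then have "E \<inter> Z = {}"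
        using \<sigma>(2) by (force simp: Z_def)
      then show ?thesis
        using EU by blast
    qed
    show "continuous_on ((U - Z) \<times> {0..1}) (\<lambda>(e, t). g (e, t))"
      using continuous_on_subset[OF g] by (simp add: Diff_subset Sigma_mono)
    show "g (e, t) \<noteq> 0" if "e \<in> U - Z" "t \<in> {0..1}" for e t
      using that by (force simp: Z_def)
    show "g (e, 0) = p e" "g (e, 1) = q e" if "e \<in> U - Z" for e
      using that gh by (auto simp: h_def)
  qed
qed

text \<open>At stage \<open>t\<close>, the point \<open>e\<close> has followed the path \<open>\<tau> e\<close> for \<open>t\<close> times a time that is 1 on \<open>A\<close> and 0
  near the complement of \<open>V\<close>.\<close>
lemma deform_along_section:
  fixes Y :: "'b::euclidean_space set" and p q :: "'b \<Rightarrow> 'a::euclidean_space"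
  assumes V: "openin (top_of_set Y) V" and A: "closedin (top_of_set Y) A" "A \<subseteq> V"
    and p: "continuous_on Y p" "\<And>e. e \<in> Y \<Longrightarrow> p e \<noteq> 0"
    and \<tau>: "continuous_on (V \<times> {0..1}) (\<lambda>(e, t). \<tau> e t)"
      "\<And>e t. e \<in> V \<Longrightarrow> t \<in> {0..1::real} \<Longrightarrow> \<tau> e t \<noteq> 0"
      "\<And>e. e \<in> V \<Longrightarrow> \<tau> e 0 = p e" "\<And>e. e \<in> V \<Longrightarrow> \<tau> e 1 = q e"
  obtains f where "continuous_on (Y \<times> {0..1}) (\<lambda>(e, t). f e t)"
      "\<And>e t. e \<in> Y \<Longrightarrow> t \<in> {0..1::real} \<Longrightarrow> f e t \<noteq> 0"
      "\<And>e. e \<in> Y \<Longrightarrow> f e 0 = p e" "\<And>e. e \<in> A \<Longrightarrow> f e 1 = q e"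
proof -
  have VY: "V \<subseteq> Y"
    using V openin_imp_subset by blast
  have "closedin (top_of_set Y) (Y - V)"
    using V by (simp add: closedin_diff)
  moreover have "(Y - V) \<inter> A = {}"
    using A(2) by auto
  ultimately obtain l :: "'b \<Rightarrow> real" where l: "continuous_on Y l" "\<And>e. e \<in> Y \<Longrightarrow> l e \<in> closed_segment 0 1"
      "\<And>e. e \<in> Y - V \<Longrightarrow> l e = 0" "\<And>e. e \<in> A \<Longrightarrow> l e = 1"
    using Urysohn_local[OF _ A(1), of "Y - V" 0 "1::real"] by blast
  have l01: "0 \<le> l e" "l e \<le> 1" if "e \<in> Y" for e
    using l(2)[OF that] by (auto simp: closed_segment_eq_real_ivl)
  \<comment> \<open>The time \<open>t * (2 * l e - 1)\<close> vanishes already at \<open>l e = 1/2\<close>, before \<open>e\<close> reaches the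
    complement of \<open>V\<close>, so that the two closed pieces fit together.\<close>
  define f where "f e t = (if 1/2 \<le> l e then \<tau> e (t * (2 * l e - 1)) else p e)" for e t
  let ?P = "{z \<in> Y \<times> {0..1::real}. 1/2 \<le> l (fst z)}" and ?Q = "{z \<in> Y \<times> {0..1::real}. l (fst z) \<le> 1/2}"
  have lf: "continuous_on (Y \<times> {0..1::real}) (\<lambda>z. l (fst z))"
    by (auto intro!: continuous_on_compose2[OF l(1)] continuous_intros)
  have inV: "e \<in> V" if "e \<in> Y" "1/2 \<le> l e" for e
    using that l(3)[of e] by fastforce
  have prod01: "t * (2 * l e - 1) \<in> {0..1}" if "e \<in> Y" "1/2 \<le> l e" "t \<in> {0..1}" for e t
    using that l01[of e] mult_le_one[of t "2 * l e - 1"] by auto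
  have cP: "continuous_on ?P (\<lambda>z. \<tau> (fst z) (snd z * (2 * l (fst z) - 1)))"
  proof -
    have PV: "(\<lambda>z. (fst z, snd z * (2 * l (fst z) - 1))) ` ?P \<subseteq> V \<times> {0..1}"
    proof (rule image_subsetI)
      fix z assume "z \<in> ?P"
      then show "(fst z, snd z * (2 * l (fst z) - 1)) \<in> V \<times> {0..1}"
        using inV[of "fst z"] prod01[of "fst z" "snd z"] by (simp add: mem_Times_iff)
    qed
    have "continuous_on ?P (\<lambda>z. (\<lambda>(e, t). \<tau> e t) (fst z, snd z * (2 * l (fst z) - 1)))"
      by (rule continuous_on_compose2[OF \<tau>(1)])
        (intro continuous_intros continuous_on_subset[OF lf] PV; blast)+
    then show ?thesis
      by simp
  qed
  have cQ: "continuous_on ?Q (\<lambda>z. p (fst z))"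
    by (auto intro!: continuous_on_compose2[OF p(1)] continuous_intros)
  have "continuous_on (?P \<union> ?Q) (\<lambda>z. if 1/2 \<le> l (fst z) then \<tau> (fst z) (snd z * (2 * l (fst z) - 1)) else p (fst z))"
  proof (rule continuous_on_cases_local[OF _ _ cP cQ])
    have PQ: "?P \<union> ?Q = Y \<times> {0..1}"
      by auto
    show "closedin (top_of_set (?P \<union> ?Q)) ?P"
      unfolding PQ using continuous_closedin_preimage[OF lf, of "{1/2..}"]
      by (simp add: vimage_def Int_def conj_commute)
    show "closedin (top_of_set (?P \<union> ?Q)) ?Q"
      unfolding PQ using continuous_closedin_preimage[OF lf, of "{..1/2}"]
      by (simp add: vimage_def Int_def conj_commute)
    show "\<tau> (fst z) (snd z * (2 * l (fst z) - 1)) = p (fst z)"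
      if "z \<in> ?P \<and> \<not> 1/2 \<le> l (fst z) \<or> z \<in> ?Q \<and> 1/2 \<le> l (fst z)" for z
    proof -
      have "l (fst z) = 1/2" "fst z \<in> V"
        using that inV[of "fst z"] by auto
      then have "2 * l (fst z) - 1 = 0" "\<tau> (fst z) 0 = p (fst z)"
        by (simp_all add: \<tau>(3))
      then show ?thesis
        by (simp only: mult_zero_right)
    qed
  qed
  moreover have "?P \<union> ?Q = Y \<times> {0..1}"
    by auto
  ultimately have cf: "continuous_on (Y \<times> {0..1}) (\<lambda>(e, t). f e t)"
    by (simp add: f_def case_prod_unfold)
  show thesis
  proof (rule that[OF cf])
    show "f e t \<noteq> 0" if "e \<in> Y" "t \<in> {0..1}" for e t
      using p(2)[OF that(1)] \<tau>(2)[OF inV prod01] that by (auto simp: f_def)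
    show "f e 0 = p e" if "e \<in> Y" for e
      using \<tau>(3)[OF inV[OF that]] by (simp add: f_def)
    show "f e 1 = q e" if "e \<in> A" for e
      using \<tau>(4)[of e] l(4)[OF that] A(2) that by (auto simp: f_def)
  qed
qed

text \<open>A Urysohn function splits \<open>Y\<close> into closed sets \<open>A\<close> and \<open>B\<close> inside the neighbourhoods to which the two
  sections extend. The first section moves \<open>p\<close> to \<open>q\<close> on \<open>A\<close>, and the second one, run backwards, moves
  \<open>q\<close> to \<open>p\<close> on \<open>B\<close>.\<close>
lemma deformations_from_two_sections:
  fixes Y E\<^sub>0 E\<^sub>1 :: "'b::euclidean_space set" and p q :: "'b \<Rightarrow> 'a::euclidean_space"
  assumes E: "locally compact E\<^sub>0" "locally compact E\<^sub>1" "E\<^sub>0 \<union> E\<^sub>1 = Y"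
    and p: "continuous_on Y p" "\<And>e. e \<in> Y \<Longrightarrow> p e \<noteq> 0"
    and q: "continuous_on Y q" "\<And>e. e \<in> Y \<Longrightarrow> q e \<noteq> 0"
    and \<sigma>\<^sub>0: "continuous_on (E\<^sub>0 \<times> {0..1}) (\<lambda>(e, t). \<sigma>\<^sub>0 e t)"
      "\<And>e t. e \<in> E\<^sub>0 \<Longrightarrow> t \<in> {0..1::real} \<Longrightarrow> \<sigma>\<^sub>0 e t \<noteq> 0"
      "\<And>e. e \<in> E\<^sub>0 \<Longrightarrow> \<sigma>\<^sub>0 e 0 = p e" "\<And>e. e \<in> E\<^sub>0 \<Longrightarrow> \<sigma>\<^sub>0 e 1 = q e"
    and \<sigma>\<^sub>1: "continuous_on (E\<^sub>1 \<times> {0..1}) (\<lambda>(e, t). \<sigma>\<^sub>1 e t)"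
      "\<And>e t. e \<in> E\<^sub>1 \<Longrightarrow> t \<in> {0..1::real} \<Longrightarrow> \<sigma>\<^sub>1 e t \<noteq> 0"
      "\<And>e. e \<in> E\<^sub>1 \<Longrightarrow> \<sigma>\<^sub>1 e 0 = p e" "\<And>e. e \<in> E\<^sub>1 \<Longrightarrow> \<sigma>\<^sub>1 e 1 = q e"
  obtains f g where
      "continuous_on (Y \<times> {0..1}) (\<lambda>(e, t). f e t)" "continuous_on (Y \<times> {0..1}) (\<lambda>(e, t). g e t)"
      "\<And>e t. e \<in> Y \<Longrightarrow> t \<in> {0..1::real} \<Longrightarrow> f e t \<noteq> 0"
      "\<And>e t. e \<in> Y \<Longrightarrow> t \<in> {0..1::real} \<Longrightarrow> g e t \<noteq> 0"
      "\<And>e. e \<in> Y \<Longrightarrow> f e 0 = p e" "\<And>e. e \<in> Y \<Longrightarrow> g e 0 = q e"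
      "\<And>e. e \<in> Y \<Longrightarrow> f e 1 = q e \<or> g e 1 = p e"
proof -
  obtain V\<^sub>0 \<tau>\<^sub>0 where V\<^sub>0: "openin (top_of_set Y) V\<^sub>0" "E\<^sub>0 \<subseteq> V\<^sub>0"
    and \<tau>\<^sub>0: "continuous_on (V\<^sub>0 \<times> {0..1}) (\<lambda>(e, t). \<tau>\<^sub>0 e t)"
      "\<And>e t. e \<in> V\<^sub>0 \<Longrightarrow> t \<in> {0..1::real} \<Longrightarrow> \<tau>\<^sub>0 e t \<noteq> 0"
      "\<And>e. e \<in> V\<^sub>0 \<Longrightarrow> \<tau>\<^sub>0 e 0 = p e" "\<And>e. e \<in> V\<^sub>0 \<Longrightarrow> \<tau>\<^sub>0 e 1 = q e"
    using section_extends_to_neighbourhood[OF E(1) _ p(1) q(1) \<sigma>\<^sub>0] E(3) by blast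
  obtain V\<^sub>1 \<tau>\<^sub>1 where V\<^sub>1: "openin (top_of_set Y) V\<^sub>1" "E\<^sub>1 \<subseteq> V\<^sub>1"
    and \<tau>\<^sub>1: "continuous_on (V\<^sub>1 \<times> {0..1}) (\<lambda>(e, t). \<tau>\<^sub>1 e t)"
      "\<And>e t. e \<in> V\<^sub>1 \<Longrightarrow> t \<in> {0..1::real} \<Longrightarrow> \<tau>\<^sub>1 e t \<noteq> 0"
      "\<And>e. e \<in> V\<^sub>1 \<Longrightarrow> \<tau>\<^sub>1 e 0 = p e" "\<And>e. e \<in> V\<^sub>1 \<Longrightarrow> \<tau>\<^sub>1 e 1 = q e"
    using section_extends_to_neighbourhood[OF E(2) _ p(1) q(1) \<sigma>\<^sub>1] E(3) by blast
  have cover: "Y \<subseteq> V\<^sub>0 \<union> V\<^sub>1"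
    using E(3) V\<^sub>0(2) V\<^sub>1(2) by blast
  have "closedin (top_of_set Y) (Y - V\<^sub>0)" "closedin (top_of_set Y) (Y - V\<^sub>1)"
    using V\<^sub>0(1) V\<^sub>1(1) by (simp_all add: closedin_diff)
  moreover have "(Y - V\<^sub>0) \<inter> (Y - V\<^sub>1) = {}"
    using cover by blast
  ultimately obtain u :: "'b \<Rightarrow> real" where u: "continuous_on Y u"
      "\<And>e. e \<in> Y - V\<^sub>0 \<Longrightarrow> u e = 0" "\<And>e. e \<in> Y - V\<^sub>1 \<Longrightarrow> u e = 1"
    using Urysohn_local[of Y "Y - V\<^sub>0" "Y - V\<^sub>1" 0 "1::real"] by metis
  define A where "A = Y \<inter> u -` {1/2..}"
  define B where "B = Y \<inter> u -` {..1/2}"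
  have AB: "closedin (top_of_set Y) A" "closedin (top_of_set Y) B" "A \<union> B = Y"
    unfolding A_def B_def by (auto intro!: continuous_closedin_preimage u)
  have A: "A \<subseteq> V\<^sub>0" and B: "B \<subseteq> V\<^sub>1"
    using u(2,3) by (force simp: A_def B_def)+
  obtain f where f: "continuous_on (Y \<times> {0..1}) (\<lambda>(e, t). f e t)"
      "\<And>e t. e \<in> Y \<Longrightarrow> t \<in> {0..1::real} \<Longrightarrow> f e t \<noteq> 0"
      "\<And>e. e \<in> Y \<Longrightarrow> f e 0 = p e" "\<And>e. e \<in> A \<Longrightarrow> f e 1 = q e"
    using deform_along_section[OF V\<^sub>0(1) AB(1) A p \<tau>\<^sub>0] by blast
  have "continuous_on (V\<^sub>1 \<times> {0..1}) (\<lambda>z. (\<lambda>(e, t). \<tau>\<^sub>1 e t) (fst z, 1 - snd z))"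
    by (rule continuous_on_compose2[OF \<tau>\<^sub>1(1)]) (auto intro!: continuous_intros)
  then have rev: "continuous_on (V\<^sub>1 \<times> {0..1}) (\<lambda>(e, t). \<tau>\<^sub>1 e (1 - t))"
    by (simp add: case_prod_unfold)
  have rev_nz: "\<tau>\<^sub>1 e (1 - t) \<noteq> 0" if "e \<in> V\<^sub>1" "t \<in> {0..1}" for e t
    using \<tau>\<^sub>1(2)[OF that(1), of "1 - t"] that(2) by simp
  have rev_ends: "\<tau>\<^sub>1 e (1 - 0) = q e" "\<tau>\<^sub>1 e (1 - 1) = p e" if "e \<in> V\<^sub>1" for e
    using \<tau>\<^sub>1(3,4)[OF that] by simp_all
  obtain g where g: "continuous_on (Y \<times> {0..1}) (\<lambda>(e, t). g e t)"
      "\<And>e t. e \<in> Y \<Longrightarrow> t \<in> {0..1::real} \<Longrightarrow> g e t \<noteq> 0"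
      "\<And>e. e \<in> Y \<Longrightarrow> g e 0 = q e" "\<And>e. e \<in> B \<Longrightarrow> g e 1 = p e"
    using deform_along_section[OF V\<^sub>1(1) AB(2) B q rev rev_nz rev_ends] by blast
  show thesis
    by (rule that[OF f(1) g(1) f(2) g(2) f(3) g(3)]) (use f(4) g(4) AB(3) in blast)+
qed

section \<open>Two sections force even dimension\<close>

lemma homotopic_with_canonI:
  fixes h :: "real \<Rightarrow> 'a::topological_space \<Rightarrow> 'b::topological_space"
  assumes "continuous_on ({0..1} \<times> S) (\<lambda>z. h (fst z) (snd z))"
    and "\<And>t x. t \<in> {0..1} \<Longrightarrow> x \<in> S \<Longrightarrow> h t x \<in> T"
    and "\<And>x. x \<in> S \<Longrightarrow> h 0 x = f x" "\<And>x. x \<in> S \<Longrightarrow> h 1 x = g x"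
  shows "homotopic_with_canon (\<lambda>_. True) S T f g"
proof -
  have "homotopic_with_canon (\<lambda>_. True) S T (h 0) (h 1)"
    unfolding homotopic_with_def
    by (rule exI[of _ "\<lambda>z. h (fst z) (snd z)"]) (use assms(1,2) in \<open>auto simp: continuous_map_in_subtopology\<close>)
  then show ?thesis
    by (rule homotopic_with_eq) (use assms(3,4) in auto)
qed

lemma homotopic_with_nonzeroI:
  fixes h :: "real \<Rightarrow> 'a::topological_space \<Rightarrow> 'b::real_normed_vector"
  assumes "continuous_on ({0..1} \<times> S) (\<lambda>z. h (fst z) (snd z))"
    and "\<And>t x. t \<in> {0..1} \<Longrightarrow> x \<in> S \<Longrightarrow> h t x \<noteq> 0"
    and "\<And>x. x \<in> S \<Longrightarrow> h 0 x = f x" "\<And>x. x \<in> S \<Longrightarrow> h 1 x = g x"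
  shows "homotopic_with_canon (\<lambda>_. True) S (- {0}) f g"
  using assms by (intro homotopic_with_canonI[where h = h]) auto

text \<open>Where \<open>x\<close> or \<open>y\<close> vanishes, \<open>sgn\<close> is discontinuous, but there the factor \<open>norm x * norm y\<close> dominates.\<close>
lemma continuous_on_bihomogeneous_extension:
  fixes \<phi> :: "('a::euclidean_space \<times> 'b::euclidean_space) \<times> real \<Rightarrow> 'c::real_normed_vector"
  assumes \<phi>: "continuous_on ((sphere 0 1 \<times> sphere 0 1) \<times> I) \<phi>"
    and bound: "\<And>z. z \<in> (sphere 0 1 \<times> sphere 0 1) \<times> I \<Longrightarrow> norm (\<phi> z) = 1"
  shows "continuous_on (UNIV \<times> I)
    (\<lambda>((x, y), t). (norm x * norm y) *\<^sub>R \<phi> ((sgn x, sgn y), t))" (is "continuous_on _ ?F")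
proof -
  \<comment> \<open>Continuity on the open set \<open>?Q\<close> is a matter of composition; off \<open>?Q\<close> the bound takes over.\<close>
  let ?Q = "((- {0}) \<times> (- {0})) \<times> (UNIV :: real set) :: (('a \<times> 'b) \<times> real) set"
  have Q: "open ?Q"
    by (intro open_Times) auto
  have "continuous_on (?Q \<inter> UNIV \<times> I) (\<lambda>z. (norm (fst (fst z)) * norm (snd (fst z))) *\<^sub>R
      \<phi> ((sgn (fst (fst z)), sgn (snd (fst z))), snd z))"
    by (intro continuous_intros continuous_on_compose2[OF \<phi>]) (auto simp: norm_sgn)
  then have cQ: "continuous_on (?Q \<inter> UNIV \<times> I) ?F"
    by (simp add: case_prod_unfold)
  have "(?F \<longlongrightarrow> ?F z) (at z within UNIV \<times> I)" if z: "z \<in> UNIV \<times> I" for z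
  proof (cases "z \<in> ?Q")
    case True
    have "at z within UNIV \<times> I = at z within (?Q \<inter> UNIV \<times> I)"
      by (rule at_within_nhd[OF True Q]) auto
    then show ?thesis
      using cQ True z by (auto simp: continuous_on_def)
  next
    case False
    let ?n = "\<lambda>z :: ('a \<times> 'b) \<times> real. norm (fst (fst z)) * norm (snd (fst z))"
    have Fz: "?F z = 0" "?n z = 0"
      using False by (auto simp: case_prod_unfold mem_Times_iff)
    have "(?n \<longlongrightarrow> ?n z) (at z within UNIV \<times> I)"
      by (intro tendsto_intros)
    moreover have "norm (?F w) \<le> ?n w" if "w \<in> UNIV \<times> I" for w
    proof (cases "w \<in> ?Q")
      case True
      then have "((sgn (fst (fst w)), sgn (snd (fst w))), snd w) \<in> (sphere 0 1 \<times> sphere 0 1) \<times> I"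
        using that by (auto simp: norm_sgn)
      then show ?thesis
        using bound by (simp add: case_prod_unfold)
    qed (auto simp: case_prod_unfold mem_Times_iff)
    ultimately show ?thesis
      unfolding Fz by (intro Lim_null_comparison[of ?F ?n]) (auto simp: eventually_at_filter)
  qed
  then show ?thesis
    by (simp add: continuous_on_def)
qed

lemma norm_if_add_scaled_unit_eq_0:
  fixes x u :: "'a::real_normed_vector"
  assumes "x + c *\<^sub>R u = 0" "0 \<le> c" "norm u = 1"
  shows "norm x = c" "x = - (norm x *\<^sub>R u)"
proof -
  have "x = - (c *\<^sub>R u)"
    using assms(1) by (simp add: eq_neg_iff_add_eq_0)
  then show "norm x = c" "x = - (norm x *\<^sub>R u)"
    using assms(2,3) by simp_all
qed

text \<open>The heart of the lower bound: if \<open>f 1\<close> and \<open>g 1\<close> agree with the opposite projections on sets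
  covering \<open>S \<times> S\<close>, then the identity of the sphere in \<open>'a \<times> 'a\<close> is homotopic, as a map into the
  nonzero vectors, to \<open>(x, y) \<mapsto> (- x, y)\<close>, which reverses \<open>DIM('a)\<close> coordinates.\<close>
lemma even_DIM_if_two_deformations:
  fixes f g :: "'a::euclidean_space \<times> 'a \<Rightarrow> real \<Rightarrow> 'a"
  defines "Y \<equiv> sphere 0 1 \<times> sphere 0 1"
  assumes f: "continuous_on (Y \<times> {0..1}) (\<lambda>(e, t). f e t)"
      "\<And>e t. e \<in> Y \<Longrightarrow> t \<in> {0..1::real} \<Longrightarrow> f e t \<noteq> 0" "\<And>e. e \<in> Y \<Longrightarrow> f e 0 = fst e"
    and g: "continuous_on (Y \<times> {0..1}) (\<lambda>(e, t). g e t)"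
      "\<And>e t. e \<in> Y \<Longrightarrow> t \<in> {0..1::real} \<Longrightarrow> g e t \<noteq> 0" "\<And>e. e \<in> Y \<Longrightarrow> g e 0 = snd e"
    and ends: "\<And>e. e \<in> Y \<Longrightarrow> f e 1 = snd e \<or> g e 1 = fst e"
  shows "even DIM('a)"
proof -
  define F where "F x y t = sgn (f (sgn x, sgn y) t)" for x y t
  define G where "G x y t = sgn (g (sgn x, sgn y) t)" for x y t
  define \<Phi> where "\<Phi> = (\<lambda>((x, y), t). (norm x * norm y) *\<^sub>R F x y t)"
  define \<Gamma> where "\<Gamma> = (\<lambda>((x, y), t). (norm x * norm y) *\<^sub>R G x y t)"
  have sgnY: "(sgn x, sgn y) \<in> Y" if "x \<noteq> 0" "y \<noteq> 0" for x y :: 'a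
    using that by (simp add: Y_def norm_sgn)
  have nFG: "norm (F x y t) = 1" "norm (G x y t) = 1" if "x \<noteq> 0" "y \<noteq> 0" "t \<in> {0..1}" for x y t
    using f(2)[OF sgnY[OF that(1,2)] that(3)] g(2)[OF sgnY[OF that(1,2)] that(3)]
    by (simp_all add: F_def G_def norm_sgn)
  have c\<Phi>: "continuous_on (UNIV \<times> {0..1}) \<Phi>"
  proof -
    have "continuous_on (Y \<times> {0..1}) (\<lambda>z. sgn ((\<lambda>(e, t). f e t) z))"
      using f(2) by (intro continuous_on_sgn f(1)) auto
    from continuous_on_bihomogeneous_extension[OF this[unfolded Y_def]] show ?thesis
      using f(2) unfolding \<Phi>_def F_def by (auto simp: norm_sgn Y_def)
  qed
  have c\<Gamma>: "continuous_on (UNIV \<times> {0..1}) \<Gamma>"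
  proof -
    have "continuous_on (Y \<times> {0..1}) (\<lambda>z. sgn ((\<lambda>(e, t). g e t) z))"
      using g(2) by (intro continuous_on_sgn g(1)) auto
    from continuous_on_bihomogeneous_extension[OF this[unfolded Y_def]] show ?thesis
      using g(2) unfolding \<Gamma>_def G_def by (auto simp: norm_sgn Y_def)
  qed
  have scale_sgn: "(r * norm v) *\<^sub>R sgn (sgn v) = r *\<^sub>R v" for r and v :: 'a
    by (cases "v = 0") (simp_all add: sgn_div_norm)
  let ?S = "sphere (0 :: 'a \<times> 'a) 1"
  define H where "H r t z = z + r *\<^sub>R (\<Gamma> (z, t), \<Phi> (z, t))" for r t and z :: "'a \<times> 'a"
  \<comment> \<open>If one coordinate of \<open>z\<close> vanishes, then so do \<open>\<Gamma>\<close> and \<open>\<Phi>\<close>, and at a zero of \<open>H r t\<close> the other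
    coordinate as well. So both are nonzero, and \<open>F\<close> and \<open>G\<close> are unit vectors.\<close>
  have zero: "norm x = r * norm x * norm y \<and> norm y = r * norm x * norm y \<and> x \<noteq> 0 \<and> y \<noteq> 0 \<and>
      x = - (norm x *\<^sub>R G x y t) \<and> y = - (norm y *\<^sub>R F x y t)"
    if "H r t (x, y) = 0" "(x, y) \<in> ?S" "0 \<le> r" "t \<in> {0..1}" for r t x y
  proof -
    have eqs: "x + (r * norm x * norm y) *\<^sub>R G x y t = 0" "y + (r * norm x * norm y) *\<^sub>R F x y t = 0"
      using that(1) by (auto simp: H_def \<Phi>_def \<Gamma>_def zero_prod_def mult.assoc)
    have nz: "x \<noteq> 0" "y \<noteq> 0"
      using eqs that(2) by (auto simp: norm_Pair)
    have c: "0 \<le> r * norm x * norm y"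
      using that(3) by simp
    show ?thesis
      using norm_if_add_scaled_unit_eq_0[OF eqs(1) c nFG(2)[OF nz that(4)]]
        norm_if_add_scaled_unit_eq_0[OF eqs(2) c nFG(1)[OF nz that(4)]] nz
      by blast
  qed
  \<comment> \<open>At a zero \<open>x\<close> is opposite to \<open>G\<close> and \<open>y\<close> to \<open>F\<close>, but at \<open>t = 1\<close> one of the two has the same
    direction.\<close>
  have h1: "homotopic_with_canon (\<lambda>_. True) ?S (- {0}) id (H 2 1)"
  proof (rule homotopic_with_nonzeroI[where h = "\<lambda>s. H (2 * s) 1"])
    show "continuous_on ({0..1} \<times> ?S) (\<lambda>z. H (2 * fst z) 1 (snd z))"
      unfolding H_def
      by (intro continuous_intros continuous_on_compose2[OF c\<Phi>] continuous_on_compose2[OF c\<Gamma>]) auto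
    show "H (2 * s) 1 z \<noteq> 0" if "s \<in> {0..1}" "z \<in> ?S" for s z
    proof
      assume H0: "H (2 * s) 1 z = 0"
      obtain x y where z: "z = (x, y)"
        by force
      have nz: "x \<noteq> 0" "y \<noteq> 0" and x: "x = - (norm x *\<^sub>R G x y 1)" and y: "y = - (norm y *\<^sub>R F x y 1)"
        using zero[of "2 * s" 1 x y] H0 that by (auto simp: z)
      from ends[OF sgnY[OF nz]] show False
      proof
        assume "f (sgn x, sgn y) 1 = snd (sgn x, sgn y)"
        then have "norm y *\<^sub>R F x y 1 = y"
          using scale_sgn[of 1 y] by (simp add: F_def)
        then show False
          using y nz by (simp add: eq_neg_iff_add_eq_0 flip: scaleR_2)
      next
        assume "g (sgn x, sgn y) 1 = fst (sgn x, sgn y)"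
        then have "norm x *\<^sub>R G x y 1 = x"
          using scale_sgn[of 1 x] by (simp add: G_def)
        then show False
          using x nz by (simp add: eq_neg_iff_add_eq_0 flip: scaleR_2)
      qed
    qed
  qed (auto simp: H_def zero_prod_def)
  \<comment> \<open>The factor 2 is chosen so that the zeros, which have both coordinates of norm \<open>1/2\<close>, are off
    the unit sphere.\<close>
  have h2: "homotopic_with_canon (\<lambda>_. True) ?S (- {0}) (H 2 1) (H 2 0)"
  proof (rule homotopic_with_nonzeroI[where h = "\<lambda>s. H 2 (1 - s)"])
    show "continuous_on ({0..1} \<times> ?S) (\<lambda>z. H 2 (1 - fst z) (snd z))"
      unfolding H_def
      by (intro continuous_intros continuous_on_compose2[OF c\<Phi>] continuous_on_compose2[OF c\<Gamma>]) auto
    show "H 2 (1 - s) z \<noteq> 0" if "s \<in> {0..1}" "z \<in> ?S" for s z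
    proof
      assume H0: "H 2 (1 - s) z = 0"
      obtain x y where z: "z = (x, y)"
        by force
      have "norm x = 2 * norm x * norm y" "norm y = 2 * norm x * norm y" "x \<noteq> 0" "y \<noteq> 0"
        using zero[of 2 "1 - s" x y] H0 that by (auto simp: z)
      then have "norm x = 1/2" "norm y = 1/2"
        by auto
      then have "(norm x)\<^sup>2 + (norm y)\<^sup>2 = 1/2"
        by (simp only: power_divide) simp
      then show False
        using that(2) by (simp add: z norm_Pair)
    qed
  qed (auto simp: H_def zero_prod_def)
  \<comment> \<open>Taking norms at a zero, a nonzero coordinate forces the other one to have norm at most \<open>1/2\<close>, so
    that the sum of the squares is less than 1.\<close>
  have h3: "homotopic_with_canon (\<lambda>_. True) ?S (- {0}) (H 2 0) prod.swap"
  proof (rule homotopic_with_nonzeroI[where h = "\<lambda>s z. (1 - s) *\<^sub>R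
        (fst z + (2 * norm (fst z)) *\<^sub>R snd z, snd z + (2 * norm (snd z)) *\<^sub>R fst z) + s *\<^sub>R prod.swap z"])
    show "(1 - s) *\<^sub>R (fst z + (2 * norm (fst z)) *\<^sub>R snd z, snd z + (2 * norm (snd z)) *\<^sub>R fst z)
        + s *\<^sub>R prod.swap z \<noteq> 0" if "s \<in> {0..1}" "z \<in> ?S" for s z
    proof
      assume 0: "(1 - s) *\<^sub>R (fst z + (2 * norm (fst z)) *\<^sub>R snd z, snd z + (2 * norm (snd z)) *\<^sub>R fst z)
        + s *\<^sub>R prod.swap z = 0"
      obtain x y where z: "z = (x, y)"
        by force
      have eqs: "(1 - s) *\<^sub>R x = - ((2 * (1 - s) * norm x + s) *\<^sub>R y)"
          "(1 - s) *\<^sub>R y = - ((2 * (1 - s) * norm y + s) *\<^sub>R x)"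
        using 0 by (simp_all add: z zero_prod_def algebra_simps eq_neg_iff_add_eq_0)
      have n: "(1 - s) * norm x = (2 * (1 - s) * norm x + s) * norm y"
          "(1 - s) * norm y = (2 * (1 - s) * norm y + s) * norm x"
        using arg_cong[OF eqs(1), of norm] arg_cong[OF eqs(2), of norm] that(1) by simp_all
      have one: "(norm x)\<^sup>2 + (norm y)\<^sup>2 = 1"
        using that(2) by (simp add: z norm_Pair)
      have s: "0 \<le> s" "s \<le> 1"
        using that(1) by auto
      show False
      proof (cases "x = 0 \<or> y = 0 \<or> s = 1")
        case True
        then show False
          using n one s by auto
      next
        case False
        have "(1 - s) * norm x * (2 * norm y) \<le> (1 - s) * norm x * 1"
          "(1 - s) * norm y * (2 * norm x) \<le> (1 - s) * norm y * 1"
          using n s by (simp_all add: algebra_simps)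
        then have "2 * norm y \<le> 1" "2 * norm x \<le> 1"
          using False s by (simp_all add: mult_le_cancel_left)
        then have "(norm x)\<^sup>2 \<le> (1/2)\<^sup>2" "(norm y)\<^sup>2 \<le> (1/2)\<^sup>2"
          by (auto intro!: power_mono)
        then show False
          using one by (simp add: power_divide)
      qed
    qed
    show "(1 - 0) *\<^sub>R (fst z + (2 * norm (fst z)) *\<^sub>R snd z, snd z + (2 * norm (snd z)) *\<^sub>R fst z)
        + 0 *\<^sub>R prod.swap z = H 2 0 z" for z
    proof -
      obtain x y where z: "z = (x, y)"
        by force
      have "\<Gamma> (z, 0) = norm x *\<^sub>R y" "\<Phi> (z, 0) = norm y *\<^sub>R x"
        using f(3)[OF sgnY, of x y] g(3)[OF sgnY, of x y] scale_sgn[of "norm x" y] scale_sgn[of "norm y" x]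
        by (cases "x = 0 \<or> y = 0"; force simp: z \<Gamma>_def \<Phi>_def G_def F_def mult.commute)+
      then show ?thesis
        by (simp add: z H_def)
    qed
  qed (auto simp: prod.swap_def intro!: continuous_intros)
  \<comment> \<open>The linear maps in between act on each plane spanned by \<open>(b, 0)\<close> and \<open>(0, b)\<close> with determinant
    \<open>- ((1 - s)\<^sup>2 + s\<^sup>2)\<close>.\<close>
  have h4: "homotopic_with_canon (\<lambda>_. True) ?S (- {0}) prod.swap (\<lambda>z. (- fst z, snd z))"
  proof (rule homotopic_with_nonzeroI[where h = "\<lambda>s z. (1 - s) *\<^sub>R prod.swap z + s *\<^sub>R (- fst z, snd z)"])
    show "(1 - s) *\<^sub>R prod.swap z + s *\<^sub>R (- fst z, snd z) \<noteq> 0" if "s \<in> {0..1}" "z \<in> ?S" for s z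
    proof
      assume 0: "(1 - s) *\<^sub>R prod.swap z + s *\<^sub>R (- fst z, snd z) = 0"
      obtain x y where z: "z = (x, y)"
        by force
      have eqs: "(1 - s) *\<^sub>R y = s *\<^sub>R x" "(1 - s) *\<^sub>R x = - (s *\<^sub>R y)"
        using 0 by (simp_all add: z zero_prod_def eq_neg_iff_add_eq_0)
      have sx: "s *\<^sub>R (1 - s) *\<^sub>R y = s *\<^sub>R s *\<^sub>R x" "(1 - s) *\<^sub>R (1 - s) *\<^sub>R y = (1 - s) *\<^sub>R s *\<^sub>R x"
        "s *\<^sub>R (1 - s) *\<^sub>R x = s *\<^sub>R (- (s *\<^sub>R y))"
        "(1 - s) *\<^sub>R (1 - s) *\<^sub>R x = (1 - s) *\<^sub>R (- (s *\<^sub>R y))"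
        by (simp_all only: eqs)
      have "((1 - s)\<^sup>2 + s\<^sup>2) *\<^sub>R v = (1 - s) *\<^sub>R (1 - s) *\<^sub>R v + s *\<^sub>R s *\<^sub>R v" for v :: 'a
        by (simp add: power2_eq_square scaleR_add_left)
      then have "((1 - s)\<^sup>2 + s\<^sup>2) *\<^sub>R x = 0" "((1 - s)\<^sup>2 + s\<^sup>2) *\<^sub>R y = 0"
        using sx by (simp_all only: scaleR_minus_right scaleR_left_commute[of "1 - s" s]) simp_all
      moreover have "(1 - s)\<^sup>2 + s\<^sup>2 \<noteq> 0"
        by (simp add: sum_power2_eq_zero_iff)
      ultimately have "x = 0" "y = 0"
        by (simp_all only: scaleR_eq_0_iff simp_thms)
      then show False
        using that(2) by (simp add: z norm_Pair)
    qed
  qed (auto simp: prod.swap_def intro!: continuous_intros)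
  define J where "J = (\<lambda>b. (b, 0 :: 'a)) ` (Basis :: 'a set)"
  have inj: "inj_on (\<lambda>b. (b, 0 :: 'a)) (Basis :: 'a set)"
    by (auto simp: inj_on_def)
  have "(\<Sum>b\<in>J. (z \<bullet> b) *\<^sub>R b) = (fst z, 0)" for z
  proof -
    have "(\<Sum>b\<in>J. (z \<bullet> b) *\<^sub>R b) = (\<Sum>b\<in>Basis. ((fst z \<bullet> b) *\<^sub>R b, 0))"
      unfolding J_def by (subst sum.reindex[OF inj]) (simp add: inner_prod_def)
    also have "\<dots> = (fst z, 0)"
      by (simp add: sum_prod euclidean_representation)
    finally show ?thesis .
  qed
  then have "(\<lambda>z. (- fst z, snd z)) = (\<lambda>z. z - 2 *\<^sub>R (\<Sum>b\<in>J. (z \<bullet> b) *\<^sub>R b))"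
    by (auto simp: fun_eq_iff prod_eq_iff scaleR_2)
  then have "homotopic_with_canon (\<lambda>_. True) ?S (- {0}) id (\<lambda>z. z - 2 *\<^sub>R (\<Sum>b\<in>J. (z \<bullet> b) *\<^sub>R b))"
    using homotopic_with_trans[OF homotopic_with_trans[OF h1 h2] homotopic_with_trans[OF h3 h4]] by simp
  then have "even (card J)"
    by (rule even_card_reflected_basis[rotated]) (auto simp: J_def Basis_prod_def)
  then show ?thesis
    by (simp add: J_def card_image[OF inj])
qed

text \<open>Translation by \<open>x\<^sub>0\<close> moves the puncture to 0, and the sections are restricted to pairs of unit
  vectors.\<close>
lemma even_DIM_if_two_sections:
  fixes x\<^sub>0 :: "'a::euclidean_space" and E\<^sub>0 E\<^sub>1 :: "('a \<times> 'a) set"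
    and s\<^sub>0 s\<^sub>1 :: "'a \<times> 'a \<Rightarrow> real \<Rightarrow> 'a"
  defines "X \<equiv> UNIV - {x\<^sub>0}"
  assumes E: "locally compact E\<^sub>0" "locally compact E\<^sub>1" "E\<^sub>0 \<union> E\<^sub>1 = X \<times> X"
    and s\<^sub>0: "continuous_on (E\<^sub>0 \<times> {0..1}) (\<lambda>(e, t). s\<^sub>0 e t)"
      "\<And>e t. e \<in> E\<^sub>0 \<Longrightarrow> t \<in> {0..1::real} \<Longrightarrow> s\<^sub>0 e t \<noteq> x\<^sub>0"
      "\<And>e. e \<in> E\<^sub>0 \<Longrightarrow> s\<^sub>0 e 0 = fst e" "\<And>e. e \<in> E\<^sub>0 \<Longrightarrow> s\<^sub>0 e 1 = snd e"
    and s\<^sub>1: "continuous_on (E\<^sub>1 \<times> {0..1}) (\<lambda>(e, t). s\<^sub>1 e t)"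
      "\<And>e t. e \<in> E\<^sub>1 \<Longrightarrow> t \<in> {0..1::real} \<Longrightarrow> s\<^sub>1 e t \<noteq> x\<^sub>0"
      "\<And>e. e \<in> E\<^sub>1 \<Longrightarrow> s\<^sub>1 e 0 = fst e" "\<And>e. e \<in> E\<^sub>1 \<Longrightarrow> s\<^sub>1 e 1 = snd e"
  shows "even DIM('a)"
proof -
  define T where "T = (\<lambda>e. (x\<^sub>0 + fst e, x\<^sub>0 + snd e))"
  define Y where "Y = sphere (0 :: 'a) 1 \<times> sphere (0 :: 'a) 1"
  have cT: "continuous_on A T" for A
    unfolding T_def by (intro continuous_intros)
  have lc: "locally compact (Y \<inter> T -` E)" if lcE: "locally compact E" for E
  proof -
    obtain C W where CW: "closed C" "open W" "E = C \<inter> W"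
      using lcE unfolding locally_compact_closed_Int_open by blast
    have "closed (Y \<inter> T -` C)"
      unfolding Y_def by (intro closed_Int closed_Times closed_sphere closed_vimage CW(1) cT)
    moreover have "open (T -` W)"
      by (intro open_vimage CW(2) cT)
    moreover have "Y \<inter> T -` E = (Y \<inter> T -` C) \<inter> T -` W"
      using CW(3) by auto
    ultimately show ?thesis
      unfolding locally_compact_closed_Int_open by blast
  qed
  have cont: "continuous_on ((Y \<inter> T -` E) \<times> {0..1}) (\<lambda>(e, t). s (T e) t - x\<^sub>0)"
    if "continuous_on (E \<times> {0..1::real}) (\<lambda>(e, t). s e t)" for E and s :: "'a \<times> 'a \<Rightarrow> real \<Rightarrow> 'a"
  proof -
    have "continuous_on ((Y \<inter> T -` E) \<times> {0..1}) (\<lambda>z. (\<lambda>(e, t). s e t) (T (fst z), snd z) - x\<^sub>0)"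
    proof (intro continuous_on_diff continuous_on_const continuous_on_compose2[OF that])
      show "continuous_on ((Y \<inter> T -` E) \<times> {0..1::real}) (\<lambda>z. (T (fst z), snd z))"
        unfolding T_def by (intro continuous_intros)
    qed auto
    then show ?thesis
      by (simp only: case_prod_unfold fst_conv snd_conv)
  qed
  have T_ends: "fst (T e) = x\<^sub>0 + fst e" "snd (T e) = x\<^sub>0 + snd e" for e
    by (simp_all add: T_def)
  have "T e \<in> X \<times> X" if "e \<in> Y" for e
    using that by (cases e) (auto simp: mem_Times_iff T_ends Y_def X_def)
  then have cover: "(Y \<inter> T -` E\<^sub>0) \<union> (Y \<inter> T -` E\<^sub>1) = Y"
    unfolding E(3)[symmetric] by blast
  have p: "continuous_on Y fst" and q: "continuous_on Y snd"
    by (intro continuous_intros)+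
  have p0: "fst e \<noteq> 0" and q0: "snd e \<noteq> 0" if "e \<in> Y" for e
    using that by (auto simp: Y_def)
  have nz: "s\<^sub>0 (T e) t - x\<^sub>0 \<noteq> 0" if "e \<in> Y \<inter> T -` E\<^sub>0" "t \<in> {0..1}" for e t
    using s\<^sub>0(2)[of "T e" t] that by simp
  have nz': "s\<^sub>1 (T e) t - x\<^sub>0 \<noteq> 0" if "e \<in> Y \<inter> T -` E\<^sub>1" "t \<in> {0..1}" for e t
    using s\<^sub>1(2)[of "T e" t] that by simp
  have ends: "s\<^sub>0 (T e) 0 - x\<^sub>0 = fst e" "s\<^sub>0 (T e) 1 - x\<^sub>0 = snd e" if "e \<in> Y \<inter> T -` E\<^sub>0" for e
    using s\<^sub>0(3,4)[of "T e"] that by (simp_all add: T_ends)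
  have ends': "s\<^sub>1 (T e) 0 - x\<^sub>0 = fst e" "s\<^sub>1 (T e) 1 - x\<^sub>0 = snd e" if "e \<in> Y \<inter> T -` E\<^sub>1" for e
    using s\<^sub>1(3,4)[of "T e"] that by (simp_all add: T_ends)
  show ?thesis
  proof (rule deformations_from_two_sections[OF lc[OF E(1)] lc[OF E(2)] cover p p0 q q0
        cont[OF s\<^sub>0(1)] nz ends cont[OF s\<^sub>1(1)] nz' ends']; (assumption)?)
    show "even DIM('a)"
      if fg: "continuous_on (Y \<times> {0..1}) (\<lambda>(e, t). f e t)" "continuous_on (Y \<times> {0..1}) (\<lambda>(e, t). g e t)"
        "\<And>e t. e \<in> Y \<Longrightarrow> t \<in> {0..1::real} \<Longrightarrow> f e t \<noteq> 0"
        "\<And>e t. e \<in> Y \<Longrightarrow> t \<in> {0..1::real} \<Longrightarrow> g e t \<noteq> 0"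
        "\<And>e. e \<in> Y \<Longrightarrow> f e 0 = fst e" "\<And>e. e \<in> Y \<Longrightarrow> g e 0 = snd e"
        "\<And>e. e \<in> Y \<Longrightarrow> f e 1 = snd e \<or> g e 1 = fst e" for f g
      by (rule even_DIM_if_two_deformations[where 'a = 'a, folded Y_def, OF fg(1,3,5,2,4,6,7)]; assumption)
  qed
qed

section \<open>Complexity of the punctured space\<close>

lemma TC_section_uncurried:
  fixes x\<^sub>0 :: "'a::euclidean_space" and E :: "('a \<times> 'a) set"
  defines "X \<equiv> UNIV - {x\<^sub>0}"
  assumes E: "E \<subseteq> X \<times> X"
    and cont: "continuous_map (subtopology (prod_topology (top_of_set X) (top_of_set X)) E) (path_space (top_of_set X)) s"
    and ends: "\<forall>(a, b)\<in>E. s (a, b) \<in> topspace (paths_between (top_of_set X) a b)"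
  shows "continuous_on (E \<times> {0..1}) (\<lambda>(e, t). s e t)"
    and "\<And>e t. e \<in> E \<Longrightarrow> t \<in> {0..1} \<Longrightarrow> s e t \<noteq> x\<^sub>0"
    and "\<And>e. e \<in> E \<Longrightarrow> s e 0 = fst e" "\<And>e. e \<in> E \<Longrightarrow> s e 1 = snd e"
proof -
  show "continuous_on (E \<times> {0..1}) (\<lambda>(e, t). s e t)"
    by (rule motion_planner_uncurry[OF E cont])
  show "s e t \<noteq> x\<^sub>0" if "e \<in> E" "t \<in> {0..1}" for e t
    using motion_planner_uncurry(2)[OF E cont that] by (simp add: X_def)
  have "s (fst e, snd e) \<in> topspace (paths_between (top_of_set X) (fst e) (snd e))" if "e \<in> E" for e
    using ends that by fastforce
  then show "s e 0 = fst e" "s e 1 = snd e" if "e \<in> E" for e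
    using that by (simp_all add: paths_between_def)
qed

text \<open>With one end point fixed, a global section contracts a sphere around \<open>x\<^sub>0\<close>.\<close>
lemma no_section_on_product:
  fixes x\<^sub>0 :: "'a::euclidean_space"
  defines "X \<equiv> UNIV - {x\<^sub>0}"
  assumes s: "continuous_on ((X \<times> X) \<times> {0..1}) (\<lambda>(e, t). s e t)"
      "\<And>e t. e \<in> X \<times> X \<Longrightarrow> t \<in> {0..1::real} \<Longrightarrow> s e t \<noteq> x\<^sub>0"
      "\<And>e. e \<in> X \<times> X \<Longrightarrow> s e 0 = fst e" "\<And>e. e \<in> X \<times> X \<Longrightarrow> s e 1 = snd e"
  shows False
proof -
  obtain b :: 'a where b: "b \<in> Basis"
    using nonempty_Basis by blast
  define c where "c = x\<^sub>0 + b"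
  have c: "c \<in> X"
    using b by (auto simp: c_def X_def)
  let ?S = "sphere x\<^sub>0 1"
  have SX: "?S \<subseteq> X"
    by (auto simp: X_def)
  have "continuous_on ({0..1} \<times> ?S) (\<lambda>z. (\<lambda>(e, t). s e t) ((snd z, c), fst z))"
    by (rule continuous_on_compose2[OF s(1)]) (use SX c in \<open>auto intro!: continuous_intros\<close>)
  then have cont: "continuous_on ({0..1} \<times> ?S) (\<lambda>z. x\<^sub>0 + sgn (s (snd z, c) (fst z) - x\<^sub>0))"
  proof (intro continuous_intros)
    show "continuous_on ({0..1} \<times> ?S) (\<lambda>z. s (snd z, c) (fst z))"
      using \<open>continuous_on _ (\<lambda>z. (\<lambda>(e, t). s e t) ((snd z, c), fst z))\<close> by simp
    show "\<forall>z\<in>{0..1} \<times> ?S. s (snd z, c) (fst z) - x\<^sub>0 \<noteq> 0"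
      using s(2) SX c by (metis mem_Times_iff eq_iff_diff_eq_0 prod.sel subsetD)
  qed
  have "homotopic_with_canon (\<lambda>_. True) ?S ?S id (\<lambda>_. x\<^sub>0 + sgn (c - x\<^sub>0))"
  proof (rule homotopic_with_canonI[where h = "\<lambda>t x. x\<^sub>0 + sgn (s (x, c) t - x\<^sub>0)"])
    show "x\<^sub>0 + sgn (s (x, c) t - x\<^sub>0) \<in> ?S" if "t \<in> {0..1}" "x \<in> ?S" for t x
      using s(2)[of "(x, c)" t] that SX c by (auto simp: dist_norm norm_sgn)
    show "x\<^sub>0 + sgn (s (x, c) 0 - x\<^sub>0) = id x" if "x \<in> ?S" for x
      using s(3)[of "(x, c)"] that SX c by (auto simp: sgn_div_norm dist_norm norm_minus_commute)
    show "x\<^sub>0 + sgn (s (x, c) 1 - x\<^sub>0) = x\<^sub>0 + sgn (c - x\<^sub>0)" if "x \<in> ?S" for x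
      using s(4)[of "(x, c)"] that SX c by auto
  qed (rule cont)
  then have "contractible ?S"
    unfolding contractible_def by blast
  then show False
    by (simp add: contractible_sphere)
qed

lemma TC_punctured_ge:
  fixes x\<^sub>0 :: "'a::euclidean_space"
  shows "(if even DIM('a) then 1 else 2) \<le> TC (top_of_set (UNIV - {x\<^sub>0}))"
proof -
  define X where "X = UNIV - {x\<^sub>0}"
  have "enat (if even DIM('a) then 1 else 2) \<le> TC (top_of_set X)"
    unfolding TC_def
  proof (rule partition_complexity_ge)
    fix k and E :: "nat \<Rightarrow> ('a \<times> 'a) set"
    assume "(\<Union>i\<le>k. E i) = topspace (top_of_set X) \<times> topspace (top_of_set X)"
      and lc: "\<And>i. i \<le> k \<Longrightarrow> locally_compact_space (subtopology (prod_topology (top_of_set X) (top_of_set X)) (E i))"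
      and sec: "\<And>i. i \<le> k \<Longrightarrow> \<exists>s. continuous_map (subtopology (prod_topology (top_of_set X) (top_of_set X)) (E i))
          (path_space (top_of_set X)) s \<and> (\<forall>(a, b)\<in>E i. s (a, b) \<in> topspace (paths_between (top_of_set X) a b))"
    then have cover: "(\<Union>i\<le>k. E i) = X \<times> X"
      by simp
    have EX: "E i \<subseteq> X \<times> X" if "i \<le> k" for i
      using cover that by blast
    have lcE: "locally compact (E i)" if "i \<le> k" for i
      using lc[OF that] unfolding subtopology_prod_top_of_set[OF EX[OF that]]
      by (simp add: locally_compact_space_top_of_set_iff)
    obtain s where s': "i \<le> k \<longrightarrow> continuous_map (subtopology (prod_topology (top_of_set X) (top_of_set X)) (E i))
          (path_space (top_of_set X)) (s i) \<and>
          (\<forall>(a, b)\<in>E i. s i (a, b) \<in> topspace (paths_between (top_of_set X) a b))" for i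
      using choice[of "\<lambda>i s. i \<le> k \<longrightarrow> continuous_map (subtopology (prod_topology (top_of_set X) (top_of_set X)) (E i))
          (path_space (top_of_set X)) s \<and> (\<forall>(a, b)\<in>E i. s (a, b) \<in> topspace (paths_between (top_of_set X) a b))"]
        sec by blast
    have s: "continuous_on (E i \<times> {0..1}) (\<lambda>(e, t). s i e t)"
        "\<And>e t. e \<in> E i \<Longrightarrow> t \<in> {0..1} \<Longrightarrow> s i e t \<noteq> x\<^sub>0"
        "\<And>e. e \<in> E i \<Longrightarrow> s i e 0 = fst e" "\<And>e. e \<in> E i \<Longrightarrow> s i e 1 = snd e" if i: "i \<le> k" for i
      using TC_section_uncurried[of "E i" x\<^sub>0 "s i", folded X_def, OF EX[OF i]] s'[of i] i by blast+
    have "k \<noteq> 0"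
    proof
      assume "k = 0"
      then have E: "E 0 = X \<times> X"
        using cover by simp
      show False
        by (rule no_section_on_product[of x\<^sub>0 "s 0", folded X_def]) (fact s[of 0, unfolded E, OF le0])+
    qed
    moreover have "k \<noteq> 1" if "odd DIM('a)"
    proof
      assume k: "k = 1"
      then have E: "E 0 \<union> E 1 = X \<times> X"
        using cover by (simp add: atMost_Suc Un_commute)
      have le: "0 \<le> k" "1 \<le> k"
        using k by simp_all
      have "even DIM('a)"
        by (rule even_DIM_if_two_sections[of "E 0" "E 1" x\<^sub>0 "s 0" "s 1", folded X_def, OF lcE[OF le(1)] lcE[OF le(2)] E])
          (fact s[OF le(1)] s[OF le(2)])+
      with that show False ..
    qed
    ultimately show "(if even DIM('a) then 1 else 2) \<le> k"
      by (cases k) (auto simp: Suc_le_eq)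
  qed
  then show ?thesis
    by (auto simp: X_def one_enat_def numeral_eq_enat split: if_splits)
qed

theorem theorem2p2:
  fixes x\<^sub>0 :: "real ^ 'n"
  assumes "CARD('n) \<ge> 2"
  shows "GC (UNIV - {x\<^sub>0}) = TC (top_of_set (UNIV - {x\<^sub>0})) \<and>
    TC (top_of_set (UNIV - {x\<^sub>0})) = (if even CARD('n) then 1 else 2)"
proof -
  have dim: "DIM(real ^ 'n) = CARD('n)"
    by simp
  note lower = TC_punctured_ge[of x\<^sub>0, unfolded dim]
  have upper: "GC (UNIV - {x\<^sub>0}) \<le> (if even CARD('n) then 1 else 2)"
    using GC_punctured_le[of x\<^sub>0] assms unfolding dim .
  note le = TC_le_GC[of "UNIV - {x\<^sub>0}"]
  show ?thesis
    by (intro conjI antisym order_trans[OF upper lower] le order_trans[OF le upper] lower)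
qed

end
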